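(* Let $E \subset \mathbb{C}$ be a compact set with connected complement $\mathbb{C}\setminus E$. Let $f = u + iv \in A(E)$, where $u$ and $v$ are the real and imaginary parts of $f$, and suppose that $f$ has no zeros on $E^0$ and that at least one of the functions $u$, $v$ is either nonnegative on all of $E^0$ or nonpositive on all of $E^0$. Then for every $\epsilon > 0$ there is a polynomial $P$ with complex coefficients having no zeros on $E$ and satisfying $|f(z) - P(z)| < \epsilon$ for all $z \in E$.
   Context: For a compact set $E \subset \mathbb{C}$, $E^0$ denotes the interior of $E$ in $\mathbb{C}$, and $A(E)$ denotes the space of all continuous functions $E \to \mathbb{C}$ that are analytic in $E^0$. *)

theory Defs
  imports "HOL-Analysis.Analysis" "HOL-Computational_Algebra.Polynomial"
begin

(* The space A(E). Functions are total here; their values outside E are unconstrained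
   and irrelevant. *)
definition space_A :: "complex set \<Rightarrow> (complex \<Rightarrow> complex) set" where
  "space_A E = {f. continuous_on E f \<and> f analytic_on interior E}"

end

theory Submission
  imports Defs "HOL-Complex_Analysis.Complex_Analysis"
begin

text \<open>
  The heart is Mergelyan's theorem. Extend \<open>f\<close> continuously with compact support and lay a grid of
  mesh \<open>d\<close> over the support. For \<open>z\<close> in \<open>K\<close>, the boundary integral of \<open>f \<zeta> / (\<zeta> - z)\<close> over the block of nine
  cells around \<open>z\<close> is \<open>2 \<pi> \<i> f z\<close> up to the oscillation of \<open>f\<close>; since the integrals over all cells add
  up to 0, \<open>f z\<close> is, up to that error, a sum of integrals over the cells off the block. Cells inside the
  interior of \<open>K\<close> contribute 0 by Cauchy. Every other cell lies in a disc of radius \<open>r = 3 d\<close> about a point of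
  the complement, and there the Cauchy kernel \<open>1 / (z - \<zeta>)\<close> is replaced by \<open>g z + (\<zeta> - m) (g z)\<^sup>2\<close>, where \<open>g\<close>
  is a uniform limit of polynomials on \<open>K\<close>, at the cost of an error \<open>O(r\<^sup>2 / \<bar>z - \<zeta>\<bar>\<^sup>3)\<close>, which is summable over
  the grid. The function \<open>g\<close> is an inverse Joukowski map: if \<open>x\<close> and \<open>b\<close> lie in one component of the disc minus
  \<open>K\<close>, then \<open>(z - x) / (z - b)\<close> has a square root on \<open>K\<close> that is a limit of polynomials.

  For the zero-free polynomial, approximate \<open>f\<close> plus a small constant that pushes \<open>f\<close> into an open half plane
  on the interior of \<open>E\<close>. The roots of the approximant in \<open>E\<close> are then limits of points of the complement
  and can be moved off \<open>E\<close>.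
\<close>

section \<open>Uniform limits of polynomials\<close>

text \<open>This is the uniform closure of the polynomials on \<open>K\<close>, usually written
  P(K), phrased for total functions: only the values on \<open>K\<close> matter.\<close>

definition poly_limit_on :: "complex set \<Rightarrow> (complex \<Rightarrow> complex) \<Rightarrow> bool" where
  "poly_limit_on K s \<longleftrightarrow> (\<forall>e>0. \<exists>P::complex poly. \<forall>z\<in>K. cmod (s z - poly P z) < e)"

lemma poly_limit_on_poly: "poly_limit_on K (poly P)"
  unfolding poly_limit_on_def by (intro allI impI exI[of _ P]) auto

lemma poly_limit_on_cong:
  assumes "poly_limit_on K f" "\<And>z. z \<in> K \<Longrightarrow> f z = g z"
  shows "poly_limit_on K g"
  using assms unfolding poly_limit_on_def by simp

lemma poly_limit_on_const: "poly_limit_on K (\<lambda>_. c)"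
  by (rule poly_limit_on_cong[OF poly_limit_on_poly[of K "[:c:]"]]) simp

lemma poly_limit_on_id: "poly_limit_on K (\<lambda>z. z)"
  by (rule poly_limit_on_cong[OF poly_limit_on_poly[of K "[:0, 1:]"]]) simp

lemma poly_limit_on_approx:
  assumes "\<And>e. e > 0 \<Longrightarrow> \<exists>g. poly_limit_on K g \<and> (\<forall>z\<in>K. cmod (f z - g z) < e)"
  shows "poly_limit_on K f"
  unfolding poly_limit_on_def
proof (intro allI impI)
  fix e :: real assume "e > 0"
  then obtain g where g: "poly_limit_on K g" "\<forall>z\<in>K. cmod (f z - g z) < e/2"
    using assms[of "e/2"] by auto
  obtain P where P: "\<forall>z\<in>K. cmod (g z - poly P z) < e/2"
    using g(1) \<open>e > 0\<close> unfolding poly_limit_on_def by (meson half_gt_zero)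
  have "cmod (f z - poly P z) < e" if "z \<in> K" for z
    using g(2) P that norm_triangle_ineq[of "f z - g z" "g z - poly P z"] by fastforce
  then show "\<exists>P. \<forall>z\<in>K. cmod (f z - poly P z) < e" by blast
qed

lemma poly_limit_on_add:
  assumes "poly_limit_on K f" "poly_limit_on K g"
  shows "poly_limit_on K (\<lambda>z. f z + g z)"
  unfolding poly_limit_on_def
proof (intro allI impI)
  fix e :: real assume "e > 0"
  then obtain P Q where P: "\<forall>z\<in>K. cmod (f z - poly P z) < e/2" and Q: "\<forall>z\<in>K. cmod (g z - poly Q z) < e/2"
    using assms unfolding poly_limit_on_def by (meson half_gt_zero)
  have "cmod (f z + g z - poly (P + Q) z) < e" if "z \<in> K" for z
    using P Q that norm_diff_triangle_ineq[of "f z" "g z" "poly P z" "poly Q z"] by fastforce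
  then show "\<exists>P. \<forall>z\<in>K. cmod (f z + g z - poly P z) < e" by blast
qed

lemma poly_limit_on_bounded:
  assumes "compact K" "poly_limit_on K f"
  obtains B where "B > 0" "\<And>z. z \<in> K \<Longrightarrow> cmod (f z) \<le> B"
proof -
  obtain P where P: "\<forall>z\<in>K. cmod (f z - poly P z) < 1"
    using assms(2) unfolding poly_limit_on_def by (meson zero_less_one)
  have "bounded (poly P ` K)"
    by (intro compact_imp_bounded compact_continuous_image assms continuous_intros)
  then obtain B where B: "B > 0" "\<And>z. z \<in> K \<Longrightarrow> cmod (poly P z) \<le> B"
    by (auto simp: bounded_pos)
  have "cmod (f z) \<le> B + 1" if "z \<in> K" for z
    using B(2)[OF that] P that norm_triangle_sub[of "f z" "poly P z"] by fastforce
  with B(1) show ?thesis by (intro that[of "B + 1"]) auto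
qed

lemma poly_limit_on_mult:
  assumes K: "compact K" and f: "poly_limit_on K f" and g: "poly_limit_on K g"
  shows "poly_limit_on K (\<lambda>z. f z * g z)"
  unfolding poly_limit_on_def
proof (intro allI impI)
  fix e :: real assume e: "e > 0"
  obtain B where B: "B > 0" "\<And>z. z \<in> K \<Longrightarrow> cmod (f z) \<le> B"
    using poly_limit_on_bounded[OF K f] by blast
  obtain Q where Q: "\<forall>z\<in>K. cmod (g z - poly Q z) < e / (2*B)"
    using g e B(1) unfolding poly_limit_on_def by (meson divide_pos_pos mult_pos_pos zero_less_numeral)
  obtain C where C: "C > 0" "\<And>z. z \<in> K \<Longrightarrow> cmod (poly Q z) \<le> C"
    using poly_limit_on_bounded[OF K poly_limit_on_poly[of K Q]] by blast
  obtain P where P: "\<forall>z\<in>K. cmod (f z - poly P z) < e / (2*C)"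
    using f e C(1) unfolding poly_limit_on_def by (meson divide_pos_pos mult_pos_pos zero_less_numeral)
  have "cmod (f z * g z - poly (P * Q) z) < e" if z: "z \<in> K" for z
  proof -
    have "f z * g z - poly (P * Q) z = f z * (g z - poly Q z) + (f z - poly P z) * poly Q z"
      by (simp add: algebra_simps)
    then have "cmod (f z * g z - poly (P * Q) z) \<le>
        cmod (f z) * cmod (g z - poly Q z) + cmod (f z - poly P z) * cmod (poly Q z)"
      by (metis norm_triangle_ineq norm_mult)
    also have "\<dots> \<le> B * cmod (g z - poly Q z) + cmod (f z - poly P z) * C"
      by (intro add_mono mult_right_mono mult_left_mono B C z) auto
    also have "\<dots> < B * (e / (2*B)) + e / (2*C) * C"
      using P Q z B(1) C(1) by (intro add_strict_mono mult_strict_left_mono mult_strict_right_mono) auto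
    also have "\<dots> = e" using B(1) C(1) by simp
    finally show ?thesis .
  qed
  then show "\<exists>P. \<forall>z\<in>K. cmod (f z * g z - poly P z) < e" by blast
qed

lemma poly_limit_on_diff:
  assumes "compact K" "poly_limit_on K f" "poly_limit_on K g"
  shows "poly_limit_on K (\<lambda>z. f z - g z)"
  using poly_limit_on_add[OF assms(2) poly_limit_on_mult[OF assms(1) poly_limit_on_const[of K "-1"] assms(3)]]
  by simp

lemma poly_limit_on_power:
  assumes "compact K" "poly_limit_on K f"
  shows "poly_limit_on K (\<lambda>z. f z ^ n)"
  by (induction n) (auto intro: poly_limit_on_const poly_limit_on_mult assms)

lemma poly_limit_on_sum:
  assumes "\<And>i. i \<in> I \<Longrightarrow> poly_limit_on K (f i)"
  shows "poly_limit_on K (\<lambda>z. \<Sum>i\<in>I. f i z)"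
  using assms
  by (induction I rule: infinite_finite_induct) (auto intro: poly_limit_on_const poly_limit_on_add)

text \<open>The Taylor series of \<open>h\<close> at 0 converges uniformly on the closed disc of
  radius \<open>\<theta>\<close>, and its partial sums in \<open>w\<close> stay in the closure
  because that is an algebra.\<close>

lemma poly_limit_on_compose_holomorphic:
  assumes K: "compact K" and w: "poly_limit_on K w" and h: "h holomorphic_on ball 0 1"
    and \<theta>: "\<theta> < 1" "\<And>z. z \<in> K \<Longrightarrow> cmod (w z) \<le> \<theta>"
  shows "poly_limit_on K (\<lambda>z. h (w z))"
proof (cases "K = {}")
  case True
  then show ?thesis unfolding poly_limit_on_def by auto
next
  case False
  then have \<theta>0: "\<theta> \<ge> 0" using \<theta>(2) norm_ge_zero order_trans by blast
  define a where "a n = (deriv ^^ n) h 0 / fact n" for n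
  have sums: "(\<lambda>n. a n * v ^ n) sums h v" if "cmod v < 1" for v
    using holomorphic_power_series[OF h, of v] that by (simp add: a_def)
  \<comment> \<open>The radius \<open>(1+\<theta>)/2\<close> lies strictly between
    \<open>\<theta>\<close> and 1. Convergence there gives absolute convergence at
    \<open>\<theta>\<close>, which is the majorant for the M-test.\<close>
  have "cmod (of_real \<theta>) < norm (of_real ((1+\<theta>)/2) :: complex)"
    using \<theta>0 \<theta>(1) by (simp only: norm_of_real) auto
  moreover have "cmod (of_real ((1+\<theta>)/2)) < 1"
    using \<theta>0 \<theta>(1) by (simp only: norm_of_real) auto
  then have "summable (\<lambda>n. a n * of_real ((1+\<theta>)/2) ^ n)"
    using sums sums_summable by blast
  ultimately have "summable (\<lambda>n. norm (a n * of_real \<theta> ^ n))"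
    using powser_insidea by blast
  then have summ: "summable (\<lambda>n. norm (a n) * \<theta> ^ n)"
    using \<theta>0 by (simp add: norm_mult norm_power)
  have ul: "uniform_limit K (\<lambda>n z. \<Sum>i<n. a i * w z ^ i) (\<lambda>z. \<Sum>i. a i * w z ^ i) sequentially"
  proof (rule Weierstrass_m_test[OF _ summ])
    show "norm (a n * w z ^ n) \<le> norm (a n) * \<theta> ^ n" if "z \<in> K" for n z
      using \<theta>(2)[OF that] by (auto simp: norm_mult norm_power intro!: mult_left_mono power_mono)
  qed
  show ?thesis
  proof (rule poly_limit_on_approx)
    fix e :: real assume "e > 0"
    from uniform_limitD[OF ul this]
    obtain n where n: "\<forall>z\<in>K. dist (\<Sum>i<n. a i * w z ^ i) (\<Sum>i. a i * w z ^ i) < e"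
      unfolding eventually_sequentially by blast
    have "(\<Sum>i. a i * w z ^ i) = h (w z)" if "z \<in> K" for z
      using sums[of "w z"] \<theta>(1) \<theta>(2)[OF that] sums_unique by (metis le_less_trans)
    with n have "\<forall>z\<in>K. cmod (h (w z) - (\<Sum>i<n. a i * w z ^ i)) < e"
      by (auto simp: dist_norm norm_minus_commute)
    moreover have "poly_limit_on K (\<lambda>z. \<Sum>i<n. a i * w z ^ i)"
      by (intro poly_limit_on_sum poly_limit_on_mult K poly_limit_on_const poly_limit_on_power w)
    ultimately show "\<exists>g. poly_limit_on K g \<and> (\<forall>z\<in>K. cmod (h (w z) - g z) < e)" by blast
  qed
qed

section \<open>Pushing poles through the complement\<close>

lemma poly_limit_on_inverse_shift:
  assumes K: "compact K" and p: "p \<notin> K" "poly_limit_on K (\<lambda>z. 1 / (z - p))"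
    and q: "q \<notin> K"
    and \<theta>: "\<theta> < 1" "\<And>z. z \<in> K \<Longrightarrow> cmod (q - p) \<le> \<theta> * cmod (z - p)"
  shows "poly_limit_on K (\<lambda>z. 1 / (z - q))"
proof -
  \<comment> \<open>Geometric series: \<open>1 / (z - q)\<close> equals \<open>1 / (z - p)\<close>
    times \<open>1 / (1 - w z)\<close>, with \<open>w\<close> bounded by \<open>\<theta>\<close> on
    \<open>K\<close>.\<close>
  define w where "w z = (q - p) * (1 / (z - p))" for z
  have nz: "z - p \<noteq> 0" if "z \<in> K" for z using that p(1) by auto
  have "poly_limit_on K w" unfolding w_def
    by (intro poly_limit_on_mult poly_limit_on_const K p)
  moreover have "(\<lambda>v. 1 / (1 - v)) holomorphic_on ball 0 1"
    by (intro holomorphic_intros) auto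
  moreover have "cmod (w z) \<le> \<theta>" if "z \<in> K" for z
    using \<theta>(2)[OF that] nz[OF that] by (simp add: w_def norm_divide divide_simps)
  ultimately have "poly_limit_on K (\<lambda>z. 1 / (1 - w z))"
    using poly_limit_on_compose_holomorphic[OF K _ _ \<theta>(1)] by blast
  then have "poly_limit_on K (\<lambda>z. 1 / (z - p) * (1 / (1 - w z)))"
    by (intro poly_limit_on_mult K p)
  then show ?thesis
  proof (rule poly_limit_on_cong)
    fix z assume z: "z \<in> K"
    have "1 - w z = (z - q) / (z - p)" using nz[OF z] by (simp add: w_def field_simps)
    moreover have "z - q \<noteq> 0" using z q by auto
    ultimately show "1 / (z - p) * (1 / (1 - w z)) = 1 / (z - q)" using nz[OF z] by simp
  qed
qed

text \<open>Runge's pole pushing: for a pole \<open>p\<close> far from \<open>K\<close> a geometric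
  series in \<open>z / p\<close> does it. Approximability then passes between nearby poles in both
  directions, hence along the connected complement.\<close>

lemma poly_limit_on_inverse:
  assumes K: "compact K" and con: "connected (- K)" and q: "q \<notin> K"
  shows "poly_limit_on K (\<lambda>z. 1 / (z - q))"
proof -
  obtain B where B: "B > 0" "\<And>z. z \<in> K \<Longrightarrow> cmod z \<le> B"
    using compact_imp_bounded[OF K] by (auto simp: bounded_pos)
  define p where "p = complex_of_real (2 * B)"
  have pn: "cmod p = 2 * B" using B(1) by (simp add: p_def)
  have pK: "p \<notin> K" using B pn by force
  have base: "poly_limit_on K (\<lambda>z. 1 / (z - p))"
  proof -
    define w where "w z = 1/p * z" for z
    have "poly_limit_on K w" unfolding w_def
      by (intro poly_limit_on_mult poly_limit_on_const K poly_limit_on_id)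
    moreover have "(\<lambda>v. 1 / (1 - v)) holomorphic_on ball 0 1"
      by (intro holomorphic_intros) auto
    moreover have "cmod (w z) \<le> 1/2" if "z \<in> K" for z
      using B(1) B(2)[OF that] by (simp add: w_def norm_divide pn divide_simps)
    ultimately have "poly_limit_on K (\<lambda>z. 1 / (1 - w z))"
      using poly_limit_on_compose_holomorphic[OF K, of w _ "1/2"] by force
    then have "poly_limit_on K (\<lambda>z. -1/p * (1 / (1 - w z)))"
      by (intro poly_limit_on_mult poly_limit_on_const K)
    then show ?thesis
    proof (rule poly_limit_on_cong)
      fix z assume z: "z \<in> K"
      have "p \<noteq> 0" using pn B(1) by auto
      moreover have "z \<noteq> p" using z pK by auto
      ultimately show "-1/p * (1 / (1 - w z)) = 1 / (z - p)"
        by (simp add: w_def divide_simps)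
    qed
  qed
  show ?thesis
  proof (rule connected_induction_simple[OF con, of p q "\<lambda>q. poly_limit_on K (\<lambda>z. 1 / (z - q))"])
    fix y assume "y \<in> - K"
    then obtain e where e: "e > 0" "ball y e \<subseteq> - K"
      using K open_Compl compact_imp_closed openE by metis
    \<comment> \<open>Two poles in \<open>ball y \<rho>\<close> are less than
      \<open>2 * \<rho>\<close> apart, while \<open>K\<close> is more than \<open>3 * \<rho>\<close>
      away from each of them; this is the ratio 2/3 used below.\<close>
    define \<rho> where "\<rho> = e / 4"
    have \<rho>: "\<rho> > 0" "e = 4 * \<rho>" using e by (auto simp: \<rho>_def)
    show "\<exists>T. openin (top_of_set (- K)) T \<and> y \<in> T \<and> (\<forall>a\<in>T. \<forall>b\<in>T. poly_limit_on K (\<lambda>z. 1 / (z - a)) \<longrightarrow> poly_limit_on K (\<lambda>z. 1 / (z - b)))"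
    proof (intro exI[of _ "ball y \<rho>"] conjI ballI impI)
      have sub: "ball y \<rho> \<subseteq> - K" using e \<rho> by force
      then show "openin (top_of_set (- K)) (ball y \<rho>)"
        by (simp add: openin_open_eq K compact_imp_closed open_Compl)
      show "y \<in> ball y \<rho>" using \<rho> by simp
      fix a b assume ab: "a \<in> ball y \<rho>" "b \<in> ball y \<rho>" "poly_limit_on K (\<lambda>z. 1 / (z - a))"
      show "poly_limit_on K (\<lambda>z. 1 / (z - b))"
      proof (rule poly_limit_on_inverse_shift[OF K _ ab(3), of b "2/3"])
        fix z assume "z \<in> K"
        then have "dist y z \<ge> 4 * \<rho>" using e \<rho> by force
        then show "cmod (b - a) \<le> 2/3 * cmod (z - a)"
          using ab(1,2) dist_triangle[of y z a] dist_triangle[of a b y]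
          by (simp add: dist_commute) (simp add: dist_norm norm_minus_commute)
      qed (use ab sub in auto)
    qed
  qed (use pK q base in auto)
qed

section \<open>Square roots of quotients of linear factors\<close>

lemma csqrt_cone:
  assumes "Re w > 0"
  shows "\<bar>Im (csqrt w)\<bar> < Re (csqrt w)"
proof -
  have "Re w = Re (csqrt w) ^ 2 - Im (csqrt w) ^ 2"
    using Re_power2[of "csqrt w"] by (simp only: power2_csqrt)
  with assms have "\<bar>Im (csqrt w)\<bar> ^ 2 < Re (csqrt w) ^ 2"
    unfolding power2_abs by linarith
  then show ?thesis by (rule power2_less_imp_less) (rule Re_csqrt)
qed

text \<open>Both roots lie in the open sector of half-angle pi/4 about the positive axis, by
  \<open>csqrt_cone\<close>. Their quotient therefore has positive real part, which singles it out
  as the principal root.\<close>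

lemma csqrt_divide:
  assumes "Re u > 0" "Re v > 0"
  shows "csqrt (u / v) = csqrt u / csqrt v"
proof (rule csqrt_unique)
  show "(csqrt u / csqrt v)\<^sup>2 = u / v" by (simp add: power_divide)
  have c: "\<bar>Im (csqrt u)\<bar> < Re (csqrt u)" "\<bar>Im (csqrt v)\<bar> < Re (csqrt v)"
    using assms csqrt_cone by auto
  have "\<bar>Im (csqrt u) * Im (csqrt v)\<bar> < Re (csqrt u) * Re (csqrt v)"
    unfolding abs_mult using c by (intro mult_strict_mono') auto
  then have "Re (csqrt u) * Re (csqrt v) + Im (csqrt u) * Im (csqrt v) > 0" by linarith
  moreover have "(Re (csqrt v))\<^sup>2 + (Im (csqrt v))\<^sup>2 > 0" using c(2)
    by (smt (verit) zero_less_power2 zero_le_power2)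
  ultimately show "0 < Re (csqrt u / csqrt v) \<or> Re (csqrt u / csqrt v) = 0 \<and> 0 \<le> Im (csqrt u / csqrt v)"
    by (simp add: Re_divide)
qed

text \<open>The quotient is \<open>1 + w z\<close> with \<open>w z = (q - p) / (z - q)\<close> of
  modulus at most \<open>\<theta>\<close>, and \<open>csqrt (1 + v)\<close> is holomorphic on the
  unit disc.\<close>

lemma poly_limit_on_csqrt_quotient:
  assumes K: "compact K" and con: "connected (- K)" and q: "q \<notin> K"
    and \<theta>: "\<theta> < 1" "\<And>z. z \<in> K \<Longrightarrow> cmod (q - p) \<le> \<theta> * cmod (z - q)"
  shows "poly_limit_on K (\<lambda>z. csqrt ((z - p) / (z - q)))"
proof -
  define w where "w z = (q - p) * (1 / (z - q))" for z
  have nz: "z - q \<noteq> 0" if "z \<in> K" for z using that q by auto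
  have "poly_limit_on K w" unfolding w_def
    by (intro poly_limit_on_mult poly_limit_on_const K poly_limit_on_inverse con q)
  moreover have "(\<lambda>v. csqrt (1 + v)) holomorphic_on ball 0 1"
  proof (intro holomorphic_intros)
    fix v :: complex assume "v \<in> ball 0 1"
    then have "Re (1 + v) > 0" using abs_Re_le_cmod[of v] by auto
    then show "1 + v \<notin> \<real>\<^sub>\<le>\<^sub>0"
      by (auto simp: complex_nonpos_Reals_iff)
  qed
  moreover have "cmod (w z) \<le> \<theta>" if "z \<in> K" for z
    using \<theta>(2)[OF that] nz[OF that] by (simp add: w_def norm_divide divide_simps)
  ultimately have "poly_limit_on K (\<lambda>z. csqrt (1 + w z))"
    using poly_limit_on_compose_holomorphic[OF K _ _ \<theta>(1)] by blast
  then show ?thesis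
  proof (rule poly_limit_on_cong)
    fix z assume z: "z \<in> K"
    show "csqrt (1 + w z) = csqrt ((z - p) / (z - q))"
      using nz[OF z] by (simp add: w_def add_divide_eq_iff)
  qed
qed

lemma Re_quotient_pos:
  assumes "cmod (p - x) < cmod (z - x)"
  shows "Re ((z - p) / (z - x)) > 0"
proof -
  have nz: "z - x \<noteq> 0" using assms by auto
  have "cmod ((p - x) / (z - x)) < 1" using assms nz by (simp add: norm_divide)
  then have "Re ((p - x) / (z - x)) < 1" using abs_Re_le_cmod[of "(p - x) / (z - x)"] by linarith
  moreover have "(z - p) / (z - x) = 1 - (p - x) / (z - x)" using nz by (simp add: field_simps)
  ultimately show ?thesis by simp
qed

text \<open>
  A branch of the square root of \<open>(z - x) / (z - b)\<close> on \<open>K\<close> that agrees outside the disc with the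
  branch tending to 1 at infinity. It is a product of principal roots of quotients
  \<open>(z - p) / (z - q)\<close> along a chain of nearby points leading from \<open>x\<close> to \<open>b\<close> off \<open>K\<close>.
\<close>
lemma square_root_branch:
  assumes K: "compact K" and con: "connected (- K)"
    and U: "open U" "connected U" "U \<subseteq> ball x r - K" "x \<in> U" "b \<in> U"
  obtains s where "poly_limit_on K s" "\<And>z. z \<in> K \<Longrightarrow> s z ^ 2 * (z - b) = z - x"
    "\<And>z. \<lbrakk>z \<in> K; r \<le> cmod (z - x)\<rbrakk> \<Longrightarrow> s z = 1 / csqrt ((z - b) / (z - x))"
proof -
  \<comment> \<open>\<open>R p q\<close> provides a root of \<open>(z - p) / (z - q)\<close>. The
    clause for points outside the disc fixes its sign through principal roots relative to the fixed
    centre \<open>x\<close>, a form that telescopes when roots along a chain are multiplied.\<close>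
  define R where "R p q \<longleftrightarrow> (\<exists>s. poly_limit_on K s \<and> (\<forall>z\<in>K. s z ^ 2 * (z - q) = z - p \<and>
    (r \<le> cmod (z - x) \<longrightarrow> s z = csqrt ((z - p) / (z - x)) / csqrt ((z - q) / (z - x)))))" for p q
  have r0: "r > 0" using U by (metis DiffD1 ball_eq_empty empty_iff not_le subsetD)
  have R_trans: "R p t" if pq: "R p q" and qt: "R q t" and q: "q \<in> U" for p q t
  proof -
    obtain s1 where s1: "poly_limit_on K s1" "\<forall>z\<in>K. s1 z ^ 2 * (z - q) = z - p \<and>
      (r \<le> cmod (z - x) \<longrightarrow> s1 z = csqrt ((z - p) / (z - x)) / csqrt ((z - q) / (z - x)))"
      using pq unfolding R_def by blast
    obtain s2 where s2: "poly_limit_on K s2" "\<forall>z\<in>K. s2 z ^ 2 * (z - t) = z - q \<and>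
      (r \<le> cmod (z - x) \<longrightarrow> s2 z = csqrt ((z - q) / (z - x)) / csqrt ((z - t) / (z - x)))"
      using qt unfolding R_def by blast
    show ?thesis unfolding R_def
    proof (intro exI[of _ "\<lambda>z. s1 z * s2 z"] conjI ballI impI)
      show "poly_limit_on K (\<lambda>z. s1 z * s2 z)" by (intro poly_limit_on_mult K s1 s2)
      fix z assume z: "z \<in> K"
      show "(s1 z * s2 z)\<^sup>2 * (z - t) = z - p"
        using s1(2) s2(2) z by (metis power_mult_distrib mult.assoc)
      assume zr: "r \<le> cmod (z - x)"
      have "z \<noteq> q" using z q U(3) by auto
      moreover have "z \<noteq> x" using zr r0 by auto
      ultimately have "csqrt ((z - q) / (z - x)) \<noteq> 0" by simp
      then show "s1 z * s2 z = csqrt ((z - p) / (z - x)) / csqrt ((z - t) / (z - x))"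
        using s1(2) s2(2) z zr by simp
    qed
  qed
  have "R x x"
    unfolding R_def
    by (intro exI[of _ "\<lambda>_. 1"] conjI ballI impI poly_limit_on_const) (use r0 in auto)
  have "R x b"
  proof (rule connected_induction_simple[OF U(2,4,5), of "R x", OF \<open>R x x\<close>])
    fix y assume "y \<in> U"
    then obtain e where e: "e > 0" "ball y e \<subseteq> U"
      using U(1) openE by blast
    define \<rho> where "\<rho> = e / 4"
    have \<rho>: "\<rho> > 0" "e = 4 * \<rho>" using e by (auto simp: \<rho>_def)
    show "\<exists>T. openin (top_of_set U) T \<and> y \<in> T \<and> (\<forall>p\<in>T. \<forall>q\<in>T. R x p \<longrightarrow> R x q)"
    proof (intro exI[of _ "ball y \<rho>"] conjI ballI impI)
      have sub: "ball y \<rho> \<subseteq> U" using e \<rho> by force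
      then show "openin (top_of_set U) (ball y \<rho>)"
        by (simp add: openin_open_eq U(1))
      show "y \<in> ball y \<rho>" using \<rho> by simp
      fix p q assume pq: "p \<in> ball y \<rho>" "q \<in> ball y \<rho>" "R x p"
      have "R p q" unfolding R_def
      proof (intro exI[of _ "\<lambda>z. csqrt ((z - p) / (z - q))"] conjI ballI impI)
        show "poly_limit_on K (\<lambda>z. csqrt ((z - p) / (z - q)))"
        proof (rule poly_limit_on_csqrt_quotient[OF K con, of q "2/3"])
          show "q \<notin> K" using pq sub U(3) by blast
          fix z assume "z \<in> K"
          then have "z \<notin> ball y e" using e U(3) by blast
          then have "dist y z \<ge> 4 * \<rho>" using \<rho> by simp
          then show "cmod (q - p) \<le> 2/3 * cmod (z - q)"
            using pq(1,2) dist_triangle[of y z q] dist_triangle[of q p y]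
            by (simp add: dist_commute) (simp add: dist_norm norm_minus_commute)
        qed simp
        fix z assume z: "z \<in> K"
        have zq: "z \<noteq> q" using z pq sub U(3) by blast
        then show "(csqrt ((z - p) / (z - q)))\<^sup>2 * (z - q) = z - p" by simp
        assume zr: "r \<le> cmod (z - x)"
        \<comment> \<open>Seen from outside the disc, both quotients by \<open>z - x\<close> lie in
          the right half plane, where principal roots respect division.\<close>
        have "p \<in> ball x r" "q \<in> ball x r" using pq sub U(3) by blast+
        then have "Re ((z - p) / (z - x)) > 0" "Re ((z - q) / (z - x)) > 0"
          using zr by (auto intro!: Re_quotient_pos simp: dist_norm norm_minus_commute)
        moreover have "(z - p) / (z - q) = ((z - p) / (z - x)) / ((z - q) / (z - x))"
          using zr r0 zq by auto
        ultimately show "csqrt ((z - p) / (z - q)) = csqrt ((z - p) / (z - x)) / csqrt ((z - q) / (z - x))"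
          using csqrt_divide by metis
      qed
      then show "R x q" using R_trans pq sub by blast
    qed
  qed
  then obtain s where s: "poly_limit_on K s" "\<forall>z\<in>K. s z ^ 2 * (z - b) = z - x \<and>
    (r \<le> cmod (z - x) \<longrightarrow> s z = csqrt ((z - x) / (z - x)) / csqrt ((z - b) / (z - x)))"
    unfolding R_def by blast
  show ?thesis
  proof (rule that[OF s(1)])
    fix z assume z: "z \<in> K" 
    show "s z ^ 2 * (z - b) = z - x" using s(2) z by blast
    assume "r \<le> cmod (z - x)"
    with s(2) z r0 show "s z = 1 / csqrt ((z - b) / (z - x))" by auto
  qed
qed

text \<open>Were the component of \<open>x\<close> contained in the closed half disc, its limit
  points off \<open>K\<close> would still lie in the open disc and so in the component. It would be
  clopen in the connected set \<open>- K\<close>, hence all of it, yet \<open>- K\<close> is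
  unbounded. The distance \<open>r / 2\<close> later keeps the focal distance of the Joukowski map
  comparable to \<open>r\<close>.\<close>

lemma component_leaves_half_disc:
  assumes K: "compact K" and con: "connected (- K)" and x: "x \<notin> K" and r: "r > 0"
  obtains U b where "open U" "connected U" "U \<subseteq> ball x r - K" "x \<in> U" "b \<in> U"
    "r / 2 \<le> cmod (b - x)"
proof -
  define V where "V = ball x r - K"
  define U where "U = connected_component_set V x"
  have V: "open V" "x \<in> V" using K x r by (auto simp: V_def compact_imp_closed open_Diff)
  have U: "open U" "connected U" "U \<subseteq> V" "x \<in> U"
    using V by (auto simp: U_def open_connected_component connected_component_subset connected_component_refl)
  have "\<exists>b\<in>U. r / 2 \<le> cmod (b - x)"
  proof (rule ccontr)
    assume "\<not> ?thesis"
    then have small: "U \<subseteq> cball x (r/2)" by (force simp: dist_norm norm_minus_commute)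
    have "closedin (top_of_set (- K)) U"
      unfolding closedin_limpt
    proof (intro conjI allI impI)
      show "U \<subseteq> - K" using U(3) by (auto simp: V_def)
      fix y assume y: "y islimpt U \<and> y \<in> - K"
      then have "y islimpt cball x (r/2)" using small islimpt_subset by blast
      then have "y \<in> cball x (r/2)" using closed_limpt closed_cball by blast
      then have "y \<in> V" using y r by (auto simp: V_def)
      then obtain e where e: "e > 0" "ball y e \<subseteq> V" using V(1) openE by blast
      obtain u where u: "u \<in> U" "u \<in> ball y e"
        using y e(1) by (metis islimpt_approachable dist_commute mem_ball)
      have "connected_component V u y"
        unfolding connected_component_def using e u by (intro exI[of _ "ball y e"]) auto
      then show "y \<in> U" using u(1) connected_component_trans unfolding U_def by fastforce
    qed
    moreover have "openin (top_of_set (- K)) U"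
      using U by (simp add: openin_open_eq K compact_imp_closed open_Compl V_def) blast
    ultimately have "U = {} \<or> U = - K"
      using con unfolding connected_clopen by simp
    then have "U = - K" using U(4) by auto
    then have "bounded (- K)" using small bounded_subset[OF bounded_cball] by simp
    then have "bounded (K \<union> - K)" using compact_imp_bounded[OF K] by (simp only: bounded_Un simp_thms)
    then show False by simp
  qed
  then show ?thesis using U that unfolding V_def by blast
qed

section \<open>Approximation of the Cauchy kernel\<close>

text \<open>
  With \<open>g = 2 / (t + S)\<close> one has \<open>g - 1/t = c\<^sup>2 / (t (t + S)\<^sup>2)\<close>: there is no term of order \<open>t\<^sup>-\<^sup>2\<close>,
  so \<open>g + h g\<^sup>2\<close> matches \<open>1 / (t - h) = 1/t + h/t\<^sup>2 + \<dots>\<close> up to third order.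
\<close>
lemma kernel_expansion:
  fixes t S c h :: complex and \<rho> r :: real
  assumes eq: "t\<^sup>2 - S\<^sup>2 = c\<^sup>2" and c: "c \<noteq> 0" "cmod c \<le> r / 2"
    and h: "cmod h \<le> 2 * r" and r: "r > 0" "4 * r \<le> \<rho>"
    and tS: "\<rho> / 2 \<le> cmod (t + S)" and t: "\<rho> / 2 \<le> cmod t" and th: "\<rho> / 2 \<le> cmod (t - h)"
  defines "g \<equiv> 2 / c\<^sup>2 * (t - S)"
  shows "cmod g \<le> 4 / \<rho>" "cmod (g + h * g\<^sup>2 - 1 / (t - h)) \<le> 40 * r\<^sup>2 / \<rho> ^ 3"
proof -
  have \<rho>: "\<rho> > 0" using r by linarith
  have nz: "t + S \<noteq> 0" "t \<noteq> 0" "t - h \<noteq> 0" using tS t th \<rho> by auto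
  have fac: "(t - S) * (t + S) = c\<^sup>2" using eq by (simp add: power2_eq_square algebra_simps)
  have g: "g = 2 / (t + S)" 
  proof -
    have "t - S \<noteq> 0" using fac c(1) by auto
    then show ?thesis unfolding g_def fac[symmetric] using nz
      by (simp add: divide_simps)
  qed
  have bnd: "cmod (1 / (t + S)) \<le> 2 / \<rho>" "cmod (1 / t) \<le> 2 / \<rho>" "cmod (1 / (t - h)) \<le> 2 / \<rho>"
    using tS t th \<rho> nz by (auto simp: norm_divide divide_simps mult.commute)
  show gb: "cmod g \<le> 4 / \<rho>"
    using bnd(1) by (simp add: g norm_divide)
  define e where "e = g - 1 / t"
  have "e = (t - S) / (t * (t + S))" unfolding e_def g using nz by (simp add: field_simps)
  also have "\<dots> = c\<^sup>2 * (1 / t) * (1 / (t + S)) * (1 / (t + S))"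
    unfolding fac[symmetric] using nz by simp
  finally have "cmod e = (cmod c)\<^sup>2 * cmod (1 / t) * cmod (1 / (t + S)) * cmod (1 / (t + S))"
    by (simp only: norm_mult norm_power)
  also have "\<dots> \<le> (r/2)\<^sup>2 * (2 / \<rho>) * (2 / \<rho>) * (2 / \<rho>)"
    using c bnd \<rho> r by (intro mult_mono power_mono) auto
  also have "\<dots> = 2 * r\<^sup>2 / \<rho> ^ 3" by (simp add: power2_eq_square power3_eq_cube)
  finally have e: "cmod e \<le> 2 * r\<^sup>2 / \<rho> ^ 3" .
  have 1: "g + h * g\<^sup>2 - 1 / (t - h) = e + h * e * (g + 1 / t) - h * h * (1/t) * (1/t) * (1 / (t - h))"
    unfolding e_def using nz by (simp add: divide_simps power2_eq_square) (simp add: algebra_simps)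
  have "cmod (g + 1 / t) \<le> 4 / \<rho> + 2 / \<rho>"
    using gb bnd(2) norm_triangle_ineq[of g "1/t"] by linarith
  then have "cmod (h * e * (g + 1 / t)) \<le> (2 * r) * (2 * r\<^sup>2 / \<rho> ^ 3) * (4 / \<rho> + 2 / \<rho>)"
    unfolding norm_mult using h e r \<rho> by (intro mult_mono) auto
  also have "\<dots> = 24 * (r / \<rho>) * (r\<^sup>2 / \<rho> ^ 3)" using \<rho> by (simp add: field_simps)
  also have "\<dots> \<le> 24 * (1/4) * (r\<^sup>2 / \<rho> ^ 3)"
    using r \<rho> by (intro mult_right_mono mult_left_mono) (auto simp: divide_simps)
  finally have 2: "cmod (h * e * (g + 1 / t)) \<le> 6 * (r\<^sup>2 / \<rho> ^ 3)" by simp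
  have "cmod (h * h * (1/t) * (1/t) * (1 / (t - h))) \<le> (2 * r) * (2 * r) * (2 / \<rho>) * (2 / \<rho>) * (2 / \<rho>)"
    unfolding norm_mult using h bnd r \<rho> by (intro mult_mono) auto
  also have "\<dots> = 32 * (r\<^sup>2 / \<rho> ^ 3)" by (simp add: power2_eq_square power3_eq_cube)
  finally have 3: "cmod (h * h * (1/t) * (1/t) * (1 / (t - h))) \<le> 32 * (r\<^sup>2 / \<rho> ^ 3)" .
  have "cmod (g + h * g\<^sup>2 - 1 / (t - h)) \<le> cmod e + cmod (h * e * (g + 1 / t)) + cmod (h * h * (1/t) * (1/t) * (1 / (t - h)))"
    unfolding 1
    using norm_triangle_ineq4[of "e + h * e * (g + 1 / t)" "h * h * (1/t) * (1/t) * (1 / (t - h))"]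
      norm_triangle_ineq[of e "h * e * (g + 1 / t)"] by linarith
  then show "cmod (g + h * g\<^sup>2 - 1 / (t - h)) \<le> 40 * r\<^sup>2 / \<rho> ^ 3"
    using e 2 3 by simp
qed

text \<open>A crude absolute constant; the largest demand on it in
  \<open>approximate_cauchy_kernel\<close> is 25640375.\<close>

definition kernel_const :: real where "kernel_const = 3 * 10 ^ 7"

text \<open>The estimates split at \<open>cmod (z - x) = 4 * r\<close>. Far out, the normalisation
  of the root at infinity makes \<open>kernel_expansion\<close> applicable. Close by, a bound of
  order \<open>1 / r\<close> suffices, since \<open>1 / r\<close> and
  \<open>r\<^sup>2 / cmod (z - \<zeta>) ^ 3\<close> are then comparable or the latter is
  larger.\<close>

lemma approximate_cauchy_kernel:
  assumes K: "compact K" and con: "connected (- K)" and x: "x \<notin> K" and r: "r > 0"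
  obtains g m where "poly_limit_on K g"
    "\<And>z \<zeta>. \<lbrakk>z \<in> K; \<zeta> \<in> ball x r\<rbrakk> \<Longrightarrow> cmod (g z + (\<zeta> - m) * (g z)\<^sup>2) \<le> kernel_const / r"
    "\<And>z \<zeta>. \<lbrakk>z \<in> K; \<zeta> \<in> ball x r; r / 3 \<le> cmod (z - \<zeta>)\<rbrakk> \<Longrightarrow>
      cmod (g z + (\<zeta> - m) * (g z)\<^sup>2 - 1 / (z - \<zeta>)) \<le> kernel_const * r\<^sup>2 / cmod (z - \<zeta>) ^ 3"
proof -
  obtain U b where U: "open U" "connected U" "U \<subseteq> ball x r - K" "x \<in> U" "b \<in> U"
    and bx: "r / 2 \<le> cmod (b - x)"
    using component_leaves_half_disc[OF K con x r] by blast
  obtain s where s: "poly_limit_on K s" "\<And>z. z \<in> K \<Longrightarrow> s z ^ 2 * (z - b) = z - x"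
    "\<And>z. \<lbrakk>z \<in> K; r \<le> cmod (z - x)\<rbrakk> \<Longrightarrow> s z = 1 / csqrt ((z - b) / (z - x))"
    using square_root_branch[OF K con U] by blast
  \<comment> \<open>The points \<open>x = m - c\<close> and \<open>b = m + c\<close> are the foci of
    the Joukowski map with centre \<open>m\<close>, and \<open>S\<close> plays the role of the root
    of \<open>(z - m)\<^sup>2 - c\<^sup>2\<close>.\<close>
  define m c where "m = (x + b) / 2" and "c = (b - x) / 2"
  define S where "S z = (z - b) * s z" for z
  define g where "g z = 2 / c\<^sup>2 * ((z - m) - S z)" for z
  have "b \<in> ball x r" using U by blast
  then have bx2: "cmod (b - x) \<le> r" by (simp add: dist_norm norm_minus_commute)
  have c: "c \<noteq> 0" "cmod c \<le> r / 2" "r / 4 \<le> cmod c"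
    using bx bx2 r by (auto simp: c_def norm_divide)
  have mx: "m - x = c" by (simp add: m_def c_def field_simps)
  have S2: "(S z)\<^sup>2 = (z - x) * (z - b)" if "z \<in> K" for z
    unfolding s(2)[OF that, symmetric] S_def by (simp add: power2_eq_square)
  have eq: "(z - m)\<^sup>2 - (S z)\<^sup>2 = c\<^sup>2" if "z \<in> K" for z
    unfolding S2[OF that] by (simp add: m_def c_def power2_eq_square field_simps)
  have far: "cmod (g z) \<le> 4 / cmod (z - x)"
      "cmod (g z + (\<zeta> - m) * (g z)\<^sup>2 - 1 / (z - \<zeta>)) \<le> 40 * r\<^sup>2 / cmod (z - x) ^ 3"
    if z: "z \<in> K" and \<zeta>: "\<zeta> \<in> ball x r" and zx: "4 * r \<le> cmod (z - x)" for z \<zeta>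
  proof -
    define \<beta> where "\<beta> = csqrt ((z - b) / (z - x))"
    have znx: "z - x \<noteq> 0" "z \<noteq> b" using zx r z U by auto
    then have \<beta>0: "\<beta> \<noteq> 0" unfolding \<beta>_def by auto
    have \<beta>2: "\<beta> * \<beta> * (z - x) = z - b"
      unfolding \<beta>_def power2_eq_square[symmetric] using znx by simp
    have "s z = 1 / \<beta>" using s(3)[OF z] zx r unfolding \<beta>_def by auto
    then have Sz: "S z = \<beta> * (z - x)"
      using \<beta>0 unfolding S_def \<beta>2[symmetric] by simp
    have zm: "z - m = ((z - x) + \<beta> * \<beta> * (z - x)) / 2"
      unfolding \<beta>2 by (simp add: m_def field_simps)
    \<comment> \<open>With this branch the sum cannot cancel: \<open>Re \<beta> \<ge> 0\<close>
      gives \<open>cmod (1 + \<beta>) \<ge> 1\<close>. The opposite sign of \<open>S\<close> would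
      give \<open>1 - \<beta>\<close> instead, which is small far out.\<close>
    have sq: "(z - m) + S z = (z - x) / 2 * (1 + \<beta>)\<^sup>2"
      unfolding zm Sz by (simp add: power2_eq_square field_simps)
    have "cmod ((z - m) + S z) = cmod (z - x) / 2 * (cmod (1 + \<beta>))\<^sup>2"
      unfolding sq by (simp add: norm_mult norm_power norm_divide)
    moreover have "Re \<beta> \<ge> 0" unfolding \<beta>_def by (rule Re_csqrt)
    then have "cmod (1 + \<beta>) \<ge> 1" using complex_Re_le_cmod[of "1 + \<beta>"] by simp
    then have "(cmod (1 + \<beta>))\<^sup>2 \<ge> 1" by simp
    ultimately have 1: "cmod (z - x) / 2 \<le> cmod ((z - m) + S z)"
      using mult_left_mono[of 1 "(cmod (1 + \<beta>))\<^sup>2" "cmod (z - x) / 2"] by simp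
    have "z - m = (z - x) - c" using mx by (simp add: algebra_simps)
    then have "cmod (z - m) \<ge> cmod (z - x) - cmod c" by (metis norm_triangle_ineq2)
    then have 2: "cmod (z - x) / 2 \<le> cmod (z - m)" using c zx r by linarith
    have \<zeta>x: "cmod (\<zeta> - x) < r" using \<zeta> by (simp add: dist_norm norm_minus_commute)
    have "cmod (z - \<zeta>) \<ge> cmod (z - x) - cmod (\<zeta> - x)"
      using norm_triangle_ineq2[of "z - x" "\<zeta> - x"] by simp
    then have 3: "cmod (z - x) / 2 \<le> cmod ((z - m) - (\<zeta> - m))" using \<zeta>x zx r by simp
    have "\<zeta> - m = (\<zeta> - x) - c" using mx by (simp add: algebra_simps)
    then have "cmod (\<zeta> - m) \<le> cmod (\<zeta> - x) + cmod c" by (metis norm_triangle_ineq4)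
    then have 4: "cmod (\<zeta> - m) \<le> 2 * r" using c \<zeta>x r by linarith
    show "cmod (g z) \<le> 4 / cmod (z - x)"
        "cmod (g z + (\<zeta> - m) * (g z)\<^sup>2 - 1 / (z - \<zeta>)) \<le> 40 * r\<^sup>2 / cmod (z - x) ^ 3"
      using kernel_expansion[OF eq[OF z] c(1,2) 4 r zx 1 2 3] by (auto simp: g_def)
  qed
  \<comment> \<open>Size alone is enough here: the numerator of \<open>g\<close> is at most
    \<open>10 * r\<close> and \<open>cmod c\<close> is at least \<open>r / 4\<close>, so the
    constant is \<open>2 * 10 * 16\<close>.\<close>
  have near: "cmod (g z) \<le> 320 / r" if z: "z \<in> K" and zx: "cmod (z - x) < 4 * r" for z
  proof -
    have "cmod (z - b) \<le> cmod (z - x) + cmod (b - x)"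
      using norm_triangle_ineq4[of "z - x" "b - x"] by simp
    then have zb: "cmod (z - b) \<le> 5 * r" using zx bx2 by linarith
    have "cmod (S z) ^ 2 = cmod (z - x) * cmod (z - b)"
      by (metis S2[OF z] norm_mult norm_power)
    also have "\<dots> \<le> (5 * r) * (5 * r)" using zx zb r by (intro mult_mono) auto
    finally have "cmod (S z) \<le> 5 * r" using r power2_le_imp_le[of "cmod (S z)" "5 * r"]
      by (simp add: power2_eq_square)
    moreover have "z - m = (z - x) - c" using mx by (simp add: algebra_simps)
    then have "cmod (z - m) \<le> cmod (z - x) + cmod c" by (metis norm_triangle_ineq4)
    ultimately have "cmod ((z - m) - S z) \<le> 10 * r"
      using norm_triangle_ineq4[of "z - m" "S z"] c zx by linarith
    moreover have "(r / 4)\<^sup>2 \<le> (cmod c)\<^sup>2" using c r by (intro power_mono) auto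
    ultimately have "2 * cmod ((z - m) - S z) / (cmod c)\<^sup>2 \<le> 2 * (10 * r) / (r / 4)\<^sup>2"
      using r by (intro frac_le) auto
    also have "\<dots> = 320 / r" using r by (simp add: power2_eq_square field_simps)
    finally show ?thesis unfolding g_def norm_mult norm_divide norm_power by simp
  qed
  have \<zeta>m: "cmod (\<zeta> - m) \<le> 2 * r" if "\<zeta> \<in> ball x r" for \<zeta>
  proof -
    have "cmod (\<zeta> - x) < r" using that by (simp add: dist_norm norm_minus_commute)
    moreover have "\<zeta> - m = (\<zeta> - x) - c" using mx by (simp add: algebra_simps)
    then have "cmod (\<zeta> - m) \<le> cmod (\<zeta> - x) + cmod c" by (metis norm_triangle_ineq4)
    ultimately show ?thesis using c r by linarith
  qed
  \<comment> \<open>The constant is \<open>320 + 2 * 320\<^sup>2\<close>.\<close>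
  have bound: "cmod (g z + (\<zeta> - m) * (g z)\<^sup>2) \<le> 205120 / r" if z: "z \<in> K" and \<zeta>: "\<zeta> \<in> ball x r" for z \<zeta>
  proof -
    have gz: "cmod (g z) \<le> 320 / r"
    proof (cases "cmod (z - x) < 4 * r")
      case True
      then show ?thesis using near z by blast
    next
      case False
      then have "cmod (g z) \<le> 4 / cmod (z - x)" using far(1)[OF z \<zeta>] by simp
      also have "\<dots> \<le> 320 / r" using False r by (intro frac_le) auto
      finally show ?thesis .
    qed
    have "cmod (g z + (\<zeta> - m) * (g z)\<^sup>2) \<le> cmod (g z) + cmod (\<zeta> - m) * (cmod (g z))\<^sup>2"
      by (metis norm_triangle_ineq norm_mult norm_power)
    also have "\<dots> \<le> 320 / r + 2 * r * (320 / r)\<^sup>2"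
      using gz \<zeta>m[OF \<zeta>] r by (intro add_mono mult_mono power_mono) auto
    also have "\<dots> = 205120 / r" using r by (simp add: power2_eq_square field_simps)
    finally show ?thesis .
  qed
  show ?thesis
  proof (rule that[of g m])
    have "poly_limit_on K S" unfolding S_def
      by (intro poly_limit_on_mult poly_limit_on_diff poly_limit_on_id poly_limit_on_const K s)
    then show "poly_limit_on K g" unfolding g_def
      by (intro poly_limit_on_mult poly_limit_on_diff poly_limit_on_id poly_limit_on_const K)
  next
    fix z \<zeta> assume z: "z \<in> K" and \<zeta>: "\<zeta> \<in> ball x r"
    have "205120 / r \<le> kernel_const / r" using r by (intro divide_right_mono) (auto simp: kernel_const_def)
    then show "cmod (g z + (\<zeta> - m) * (g z)\<^sup>2) \<le> kernel_const / r"
      using bound[OF z \<zeta>] by linarith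
    assume d: "r / 3 \<le> cmod (z - \<zeta>)"
    define D where "D = cmod (z - \<zeta>)"
    have D0: "D > 0" using d r unfolding D_def by linarith
    have \<zeta>x: "cmod (\<zeta> - x) < r" using \<zeta> by (simp add: dist_norm norm_minus_commute)
    have Dx: "D \<le> cmod (z - x) + r" unfolding D_def
      using norm_triangle_ineq4[of "z - x" "\<zeta> - x"] \<zeta>x by simp
    show "cmod (g z + (\<zeta> - m) * (g z)\<^sup>2 - 1 / (z - \<zeta>)) \<le> kernel_const * r\<^sup>2 / cmod (z - \<zeta>) ^ 3"
    proof (cases "cmod (z - x) < 4 * r")
      case True
      have "cmod (1 / (z - \<zeta>)) \<le> 3 / r"
        using d D0 r unfolding D_def by (auto simp: norm_divide divide_simps)
      then have "cmod (g z + (\<zeta> - m) * (g z)\<^sup>2 - 1 / (z - \<zeta>)) \<le> 205120 / r + 3 / r"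
        using bound[OF z \<zeta>] norm_triangle_ineq4[of "g z + (\<zeta> - m) * (g z)\<^sup>2" "1 / (z - \<zeta>)"] by linarith
      \<comment> \<open>Here \<open>D\<close> is at most \<open>5 * r\<close>, so
        \<open>1 / r\<close> is rewritten as \<open>125 * r\<^sup>2 / (5 * r) ^ 3\<close>; the
        numerator is \<open>125 * 205123\<close>.\<close>
      also have "\<dots> = 25640375 * r\<^sup>2 / (5 * r) ^ 3" using r by (simp add: power2_eq_square power3_eq_cube field_simps)
      also have "\<dots> \<le> kernel_const * r\<^sup>2 / D ^ 3"
        using Dx True D0 r
        by (intro frac_le power_mono mult_right_mono) (auto simp: kernel_const_def)
      finally show ?thesis by (simp add: D_def)
    next
      case False
      then have "D / 2 \<le> cmod (z - x)" using Dx r by linarith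
      have "cmod (g z + (\<zeta> - m) * (g z)\<^sup>2 - 1 / (z - \<zeta>)) \<le> 40 * r\<^sup>2 / cmod (z - x) ^ 3"
        using far(2)[OF z \<zeta>] False by simp
      also have "\<dots> \<le> 40 * r\<^sup>2 / (D / 2) ^ 3"
        using \<open>D / 2 \<le> _\<close> D0 r by (intro frac_le power_mono) auto
      also have "\<dots> = 320 * r\<^sup>2 / D ^ 3" by (simp add: power3_eq_cube)
      also have "\<dots> \<le> kernel_const * r\<^sup>2 / D ^ 3"
        using D0 r by (intro divide_right_mono mult_right_mono) (auto simp: kernel_const_def)
      finally show ?thesis by (simp add: D_def)
    qed
  qed
qed

section \<open>Integrals over a square grid\<close>

text \<open>Opposite sides are given the same orientation, matching the sign convention of
  \<open>sqint\<close>, so that closed rectangular paths can be compared with sums of grid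
  edges.\<close>

lemma contour_integral_quadrilateral:
  assumes "continuous_on (closed_segment p q) h" "continuous_on (closed_segment q r) h"
    "continuous_on (closed_segment s r) h" "continuous_on (closed_segment p s) h"
  shows "contour_integral (linepath p q +++ linepath q r +++ linepath r s +++ linepath s p) h =
    contour_integral (linepath p q) h + contour_integral (linepath q r) h -
    contour_integral (linepath s r) h - contour_integral (linepath p s) h"
proof -
  have int: "h contour_integrable_on linepath p q" "h contour_integrable_on linepath q r"
      "h contour_integrable_on linepath r s" "h contour_integrable_on linepath s p"
    using assms by (auto intro!: contour_integrable_continuous_linepath simp: closed_segment_commute)
  then have "contour_integral (linepath p q +++ linepath q r +++ linepath r s +++ linepath s p) h =
      contour_integral (linepath p q) h + (contour_integral (linepath q r) h +
      (contour_integral (linepath r s) h + contour_integral (linepath s p) h))"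
    by (simp add: contour_integrable_joinI valid_path_join)
  moreover have "contour_integral (linepath r s) h = - contour_integral (linepath s r) h"
    "contour_integral (linepath s p) h = - contour_integral (linepath p s) h"
    using contour_integral_reversepath[OF valid_path_linepath] by (metis reversepath_linepath)+
  ultimately show ?thesis by simp
qed

locale square_grid =
  fixes a :: complex and d :: real
  assumes d_pos: "d > 0"
begin

definition pt :: "nat \<Rightarrow> nat \<Rightarrow> complex" where
  "pt i j = a + of_real d * Complex (real i) (real j)"

definition hor :: "(complex \<Rightarrow> complex) \<Rightarrow> nat \<Rightarrow> nat \<Rightarrow> complex" where
  "hor h i j = contour_integral (linepath (pt i j) (pt (Suc i) j)) h"

definition ver :: "(complex \<Rightarrow> complex) \<Rightarrow> nat \<Rightarrow> nat \<Rightarrow> complex" where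
  "ver h i j = contour_integral (linepath (pt i j) (pt i (Suc j))) h"

text \<open>The counterclockwise boundary integral of a cell, split into edges with fixed
  orientation so that neighbouring cells share literally the same term with opposite signs.\<close>

definition sqint :: "(complex \<Rightarrow> complex) \<Rightarrow> nat \<Rightarrow> nat \<Rightarrow> complex" where
  "sqint h i j = hor h i j + ver h (Suc i) j - hor h i (Suc j) - ver h i j"

definition cell :: "nat \<Rightarrow> nat \<Rightarrow> complex set" where
  "cell i j = cbox (pt i j) (pt (Suc i) (Suc j))"

definition block_boundary :: "(complex \<Rightarrow> complex) \<Rightarrow> nat \<Rightarrow> nat \<Rightarrow> nat \<Rightarrow> nat \<Rightarrow> complex" where
  "block_boundary h m n k l =
     (\<Sum>i=m..<n. hor h i k - hor h i l) + (\<Sum>j=k..<l. ver h n j - ver h m j)"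

lemma Re_pt [simp]: "Re (pt i j) = Re a + d * real i"
  and Im_pt [simp]: "Im (pt i j) = Im a + d * real j"
  by (auto simp: pt_def)

text \<open>
  Pure bookkeeping: this holds for arbitrary edge values, in particular when \<open>h\<close> is not integrable
  along some inner edges, where \<^const>\<open>contour_integral\<close> is a junk value.
\<close>
lemma sum_sqint:
  assumes "m \<le> n" "k \<le> l"
  shows "(\<Sum>i=m..<n. \<Sum>j=k..<l. sqint h i j) = block_boundary h m n k l"
proof -
  have 1: "(\<Sum>j=k..<l. hor h i j - hor h i (Suc j)) = hor h i k - hor h i l" for i
    using sum_Suc_diff'[OF assms(2), of "\<lambda>j. - hor h i j"] by simp
  have 2: "(\<Sum>i=m..<n. ver h (Suc i) j - ver h i j) = ver h n j - ver h m j" for j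
    using sum_Suc_diff'[OF assms(1), of "\<lambda>i. ver h i j"] by simp
  have "(\<Sum>i=m..<n. \<Sum>j=k..<l. sqint h i j) =
      (\<Sum>i=m..<n. \<Sum>j=k..<l. hor h i j - hor h i (Suc j)) + (\<Sum>i=m..<n. \<Sum>j=k..<l. ver h (Suc i) j - ver h i j)"
    unfolding sum.distrib[symmetric] by (simp add: sqint_def algebra_simps)
  also have "(\<Sum>i=m..<n. \<Sum>j=k..<l. ver h (Suc i) j - ver h i j) = (\<Sum>j=k..<l. ver h n j - ver h m j)"
    by (subst sum.swap) (simp only: 2)
  finally show ?thesis by (simp only: 1 block_boundary_def)
qed

lemma pt_in_cell: "pt i j \<in> cell i j" "pt (Suc i) j \<in> cell i j" "pt i (Suc j) \<in> cell i j"
   "pt (Suc i) (Suc j) \<in> cell i j"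
  using d_pos by (auto simp: cell_def in_cbox_complex_iff)

lemma segments_in_cell:
  "closed_segment (pt i j) (pt (Suc i) j) \<subseteq> cell i j"
  "closed_segment (pt i j) (pt i (Suc j)) \<subseteq> cell i j"
  "closed_segment (pt (Suc i) j) (pt (Suc i) (Suc j)) \<subseteq> cell i j"
  "closed_segment (pt i (Suc j)) (pt (Suc i) (Suc j)) \<subseteq> cell i j"
proof -
  have "convex (cell i j)" by (simp add: cell_def)
  then show "closed_segment (pt i j) (pt (Suc i) j) \<subseteq> cell i j"
    "closed_segment (pt i j) (pt i (Suc j)) \<subseteq> cell i j"
    "closed_segment (pt (Suc i) j) (pt (Suc i) (Suc j)) \<subseteq> cell i j"
    "closed_segment (pt i (Suc j)) (pt (Suc i) (Suc j)) \<subseteq> cell i j"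
    by (simp_all add: closed_segment_subset pt_in_cell)
qed

lemma edge_length: "cmod (pt (Suc i) j - pt i j) = d" "cmod (pt i (Suc j) - pt i j) = d"
proof -
  have "pt (Suc i) j - pt i j = of_real d" "pt i (Suc j) - pt i j = \<i> * of_real d"
    by (auto simp: complex_eq_iff algebra_simps)
  then show "cmod (pt (Suc i) j - pt i j) = d" "cmod (pt i (Suc j) - pt i j) = d"
    using d_pos by (auto simp: norm_mult)
qed

lemma norm_hor_le:
  assumes "continuous_on (closed_segment (pt i j) (pt (Suc i) j)) h"
    "\<And>\<zeta>. \<zeta> \<in> closed_segment (pt i j) (pt (Suc i) j) \<Longrightarrow> cmod (h \<zeta>) \<le> B"
  shows "cmod (hor h i j) \<le> B * d"
proof -
  have "B \<ge> 0" using assms(2)[of "pt i j"] norm_ge_zero order_trans by (metis ends_in_segment(1))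
  then have "cmod (contour_integral (linepath (pt i j) (pt (Suc i) j)) h) \<le> B * cmod (pt (Suc i) j - pt i j)"
    by (intro contour_integral_bound_linepath contour_integrable_continuous_linepath assms)
  then show ?thesis by (simp add: hor_def edge_length)
qed

lemma norm_ver_le:
  assumes "continuous_on (closed_segment (pt i j) (pt i (Suc j))) h"
    "\<And>\<zeta>. \<zeta> \<in> closed_segment (pt i j) (pt i (Suc j)) \<Longrightarrow> cmod (h \<zeta>) \<le> B"
  shows "cmod (ver h i j) \<le> B * d"
proof -
  have "B \<ge> 0" using assms(2)[of "pt i j"] norm_ge_zero order_trans by (metis ends_in_segment(1))
  then have "cmod (contour_integral (linepath (pt i j) (pt i (Suc j))) h) \<le> B * cmod (pt i (Suc j) - pt i j)"
    by (intro contour_integral_bound_linepath contour_integrable_continuous_linepath assms)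
  then show ?thesis by (simp add: ver_def edge_length)
qed

lemma norm_sqint_le:
  assumes h: "continuous_on (cell i j) h" "\<And>\<zeta>. \<zeta> \<in> cell i j \<Longrightarrow> cmod (h \<zeta>) \<le> B"
  shows "cmod (sqint h i j) \<le> 4 * d * B"
proof -
  note seg = segments_in_cell[of i j]
  have "cmod (hor h i j) \<le> B * d" "cmod (hor h i (Suc j)) \<le> B * d"
    using seg by (auto intro!: norm_hor_le continuous_on_subset[OF h(1)] h(2))
  moreover have "cmod (ver h i j) \<le> B * d" "cmod (ver h (Suc i) j) \<le> B * d"
    using seg by (auto intro!: norm_ver_le continuous_on_subset[OF h(1)] h(2))
  moreover have "cmod (sqint h i j) \<le> cmod (hor h i j) + cmod (ver h (Suc i) j) + cmod (hor h i (Suc j)) + cmod (ver h i j)"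
    unfolding sqint_def
    using norm_triangle_ineq4[of "hor h i j + ver h (Suc i) j - hor h i (Suc j)" "ver h i j"]
      norm_triangle_ineq4[of "hor h i j + ver h (Suc i) j" "hor h i (Suc j)"]
      norm_triangle_ineq[of "hor h i j" "ver h (Suc i) j"] by linarith
  ultimately show ?thesis by (simp add: algebra_simps)
qed

lemma integrable_edges:
  assumes "continuous_on (cell i j) h"
  shows "h contour_integrable_on linepath (pt i j) (pt (Suc i) j)"
    "h contour_integrable_on linepath (pt i j) (pt i (Suc j))"
    "h contour_integrable_on linepath (pt (Suc i) j) (pt (Suc i) (Suc j))"
    "h contour_integrable_on linepath (pt i (Suc j)) (pt (Suc i) (Suc j))"
  using segments_in_cell[of i j]
  by (auto intro!: contour_integrable_continuous_linepath continuous_on_subset[OF assms])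

lemma sqint_add:
  assumes "continuous_on (cell i j) h1" "continuous_on (cell i j) h2"
  shows "sqint (\<lambda>\<zeta>. h1 \<zeta> + h2 \<zeta>) i j = sqint h1 i j + sqint h2 i j"
  using integrable_edges[OF assms(1)] integrable_edges[OF assms(2)]
  by (simp add: sqint_def hor_def ver_def contour_integral_add)

lemma sqint_lmul:
  assumes "continuous_on (cell i j) h"
  shows "sqint (\<lambda>\<zeta>. c * h \<zeta>) i j = c * sqint h i j"
  using integrable_edges[OF assms]
  by (simp add: sqint_def hor_def ver_def contour_integral_lmul algebra_simps)

lemma sqint_holomorphic:
  assumes h: "h holomorphic_on S" and S: "open S" "cell i j \<subseteq> S"
  shows "sqint h i j = 0"
proof -
  have hc: "continuous_on (cell i j) h"
    using h S(2) holomorphic_on_imp_continuous_on continuous_on_subset by blast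
  have rc: "Complex (Re (pt (Suc i) (Suc j))) (Im (pt i j)) = pt (Suc i) j"
    "Complex (Re (pt i j)) (Im (pt (Suc i) (Suc j))) = pt i (Suc j)"
    by (auto simp: complex_eq_iff)
  have rp: "rectpath (pt i j) (pt (Suc i) (Suc j)) = linepath (pt i j) (pt (Suc i) j) +++
      linepath (pt (Suc i) j) (pt (Suc i) (Suc j)) +++
      linepath (pt (Suc i) (Suc j)) (pt i (Suc j)) +++ linepath (pt i (Suc j)) (pt i j)"
    unfolding rectpath_def Let_def rc ..
  have "(h has_contour_integral 0) (rectpath (pt i j) (pt (Suc i) (Suc j)))"
  proof (rule Cauchy_theorem_convex_simple)
    show "h holomorphic_on cell i j" using h S(2) holomorphic_on_subset by blast
    show "convex (cell i j)" by (simp add: cell_def)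
    show "path_image (rectpath (pt i j) (pt (Suc i) (Suc j))) \<subseteq> cell i j"
      unfolding cell_def using d_pos by (intro path_image_rectpath_subset_cbox) auto
  qed auto
  then have "contour_integral (rectpath (pt i j) (pt (Suc i) (Suc j))) h = 0"
    by (rule contour_integral_unique)
  moreover have "contour_integral (rectpath (pt i j) (pt (Suc i) (Suc j))) h = sqint h i j"
    unfolding rp sqint_def hor_def ver_def
    using segments_in_cell[of i j]
    by (intro contour_integral_quadrilateral continuous_on_subset[OF hc])
  ultimately show ?thesis by simp
qed

lemma sum_hor:
  assumes "m \<le> n" "continuous_on (closed_segment (pt m j) (pt n j)) h"
  shows "(\<Sum>i=m..<n. hor h i j) = contour_integral (linepath (pt m j) (pt n j)) h"
  using assms
proof (induction n rule: dec_induct)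
  case base
  show ?case unfolding contour_integral_trivial by simp
next
  case (step n)
  have "d * real m \<le> d * real n" using step.hyps d_pos by simp
  then have "d * real m \<le> d + d * real n" using d_pos by linarith
  then have in_seg: "pt n j \<in> closed_segment (pt m j) (pt (Suc n) j)"
    using step.hyps d_pos by (simp add: closed_segment_same_Im closed_segment_eq_real_ivl algebra_simps)
  have "continuous_on (closed_segment (pt m j) (pt n j)) h"
    by (rule continuous_on_subset[OF step.prems]) (use in_seg in \<open>simp add: closed_segment_subset\<close>)
  then show ?case
    using step.IH step.hyps contour_integral_split_linepath[OF step.prems in_seg] by (simp add: hor_def)
qed

lemma sum_ver:
  assumes "k \<le> l" "continuous_on (closed_segment (pt i k) (pt i l)) h"
  shows "(\<Sum>j=k..<l. ver h i j) = contour_integral (linepath (pt i k) (pt i l)) h"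
  using assms
proof (induction l rule: dec_induct)
  case base
  show ?case unfolding contour_integral_trivial by simp
next
  case (step n)
  have "d * real k \<le> d * real n" using step.hyps d_pos by simp
  then have "d * real k \<le> d + d * real n" using d_pos by linarith
  then have in_seg: "pt i n \<in> closed_segment (pt i k) (pt i (Suc n))"
    using step.hyps d_pos by (simp add: closed_segment_same_Re closed_segment_eq_real_ivl algebra_simps)
  have "continuous_on (closed_segment (pt i k) (pt i n)) h"
    by (rule continuous_on_subset[OF step.prems]) (use in_seg in \<open>simp add: closed_segment_subset\<close>)
  then show ?case
    using step.IH step.hyps contour_integral_split_linepath[OF step.prems in_seg] by (simp add: ver_def)
qed

text \<open>The edges assemble into the four sides of a rectangle, whose winding number about an
  inner point is 1.\<close>

lemma block_boundary_inverse:
  assumes z: "z \<in> box (pt m k) (pt n l)"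
  shows "block_boundary (\<lambda>\<zeta>. 1 / (\<zeta> - z)) m n k l = 2 * of_real pi * \<i>"
proof -
  let ?h = "\<lambda>\<zeta>. 1 / (\<zeta> - z)"
  let ?R = "rectpath (pt m k) (pt n l)"
  have Re: "Re a + d * real m < Re z" "Re z < Re a + d * real n"
    and Im: "Im a + d * real k < Im z" "Im z < Im a + d * real l"
    using z by (auto simp: in_box_complex_iff)
  have "d * real m < d * real n" "d * real k < d * real l" using Re Im by linarith+
  then have mn: "m \<le> n" "k \<le> l" using d_pos by auto
  have rc: "Complex (Re (pt n l)) (Im (pt m k)) = pt n k"
    "Complex (Re (pt m k)) (Im (pt n l)) = pt m l"
    by (auto simp: complex_eq_iff)
  have rp: "?R = linepath (pt m k) (pt n k) +++ linepath (pt n k) (pt n l) +++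
      linepath (pt n l) (pt m l) +++ linepath (pt m l) (pt m k)"
    unfolding rectpath_def Let_def rc ..
  have seg: "z \<notin> closed_segment (pt m k) (pt n k)" "z \<notin> closed_segment (pt n k) (pt n l)"
    "z \<notin> closed_segment (pt m l) (pt n l)" "z \<notin> closed_segment (pt m k) (pt m l)"
    using Re Im by (auto simp: closed_segment_same_Re closed_segment_same_Im)
  have cont: "continuous_on T ?h" if "z \<notin> T" for T
    using that by (intro continuous_intros) auto
  have zp: "z \<notin> path_image ?R"
    using seg by (simp add: rp path_image_join closed_segment_commute)
  have "2 * of_real pi * \<i> * winding_number ?R z = contour_integral ?R ?h"
    using winding_number_valid_path[OF valid_path_rectpath zp] by simp
  then have "contour_integral ?R ?h = 2 * of_real pi * \<i>"
    using winding_number_rectpath[OF z] by simp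
  moreover have "contour_integral ?R ?h = contour_integral (linepath (pt m k) (pt n k)) ?h +
     contour_integral (linepath (pt n k) (pt n l)) ?h - contour_integral (linepath (pt m l) (pt n l)) ?h -
       contour_integral (linepath (pt m k) (pt m l)) ?h"
    unfolding rp by (intro contour_integral_quadrilateral seg[THEN cont])
  ultimately show ?thesis
    unfolding block_boundary_def sum_subtractf
    using seg[THEN cont] mn by (simp add: sum_hor sum_ver algebra_simps)
qed

text \<open>On an edge of length \<open>d\<close> at distance at least \<open>d\<close> from
  \<open>z\<close>, the integrand \<open>(f \<zeta> - f z) / (\<zeta> - z)\<close> is at most
  \<open>\<epsilon> / d\<close>. The upper bound \<open>5 * d\<close> brings the edge within reach
  of the oscillation hypothesis.\<close>

lemma norm_edge_cauchy_diff_le: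
  assumes f: "continuous_on UNIV f" and \<epsilon>: "\<And>\<zeta>. cmod (\<zeta> - z) \<le> 5 * d \<Longrightarrow> cmod (f \<zeta> - f z) \<le> \<epsilon>"
  shows "(\<And>\<zeta>. \<zeta> \<in> closed_segment (pt i j) (pt (Suc i) j) \<Longrightarrow> d \<le> cmod (\<zeta> - z) \<and> cmod (\<zeta> - z) \<le> 5 * d) \<Longrightarrow>
      cmod (hor (\<lambda>\<zeta>. f \<zeta> / (\<zeta> - z)) i j - f z * hor (\<lambda>\<zeta>. 1 / (\<zeta> - z)) i j) \<le> \<epsilon>"
    and "(\<And>\<zeta>. \<zeta> \<in> closed_segment (pt i j) (pt i (Suc j)) \<Longrightarrow> d \<le> cmod (\<zeta> - z) \<and> cmod (\<zeta> - z) \<le> 5 * d) \<Longrightarrow>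
      cmod (ver (\<lambda>\<zeta>. f \<zeta> / (\<zeta> - z)) i j - f z * ver (\<lambda>\<zeta>. 1 / (\<zeta> - z)) i j) \<le> \<epsilon>"
proof -
  have cont: "continuous_on T (\<lambda>\<zeta>. f \<zeta> / (\<zeta> - z))" "continuous_on T (\<lambda>\<zeta>. 1 / (\<zeta> - z))"
      "continuous_on T (\<lambda>\<zeta>. f z * (1 / (\<zeta> - z)))" "continuous_on T (\<lambda>\<zeta>. f \<zeta> / (\<zeta> - z) - f z * (1 / (\<zeta> - z)))"
    if "\<And>\<zeta>. \<zeta> \<in> T \<Longrightarrow> d \<le> cmod (\<zeta> - z) \<and> cmod (\<zeta> - z) \<le> 5 * d" for T
  proof -
    have "z \<notin> T" using that[of z] d_pos by auto
    moreover have "continuous_on T f" using f continuous_on_subset by blast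
    ultimately show "continuous_on T (\<lambda>\<zeta>. f \<zeta> / (\<zeta> - z))" "continuous_on T (\<lambda>\<zeta>. 1 / (\<zeta> - z))"
        "continuous_on T (\<lambda>\<zeta>. f z * (1 / (\<zeta> - z)))" "continuous_on T (\<lambda>\<zeta>. f \<zeta> / (\<zeta> - z) - f z * (1 / (\<zeta> - z)))"
      by (auto intro!: continuous_intros)
  qed
  have bound: "cmod (f \<zeta> / (\<zeta> - z) - f z * (1 / (\<zeta> - z))) \<le> \<epsilon> / d"
    if "d \<le> cmod (\<zeta> - z) \<and> cmod (\<zeta> - z) \<le> 5 * d" for \<zeta>
  proof -
    have "f \<zeta> / (\<zeta> - z) - f z * (1 / (\<zeta> - z)) = (f \<zeta> - f z) / (\<zeta> - z)"
      by (simp add: diff_divide_distrib)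
    moreover have "cmod (f \<zeta> - f z) / cmod (\<zeta> - z) \<le> \<epsilon> / d"
      using that \<epsilon>[of \<zeta>] d_pos by (intro frac_le) (auto intro: order_trans[OF norm_ge_zero])
    ultimately show ?thesis by (simp add: norm_divide)
  qed
  show "cmod (hor (\<lambda>\<zeta>. f \<zeta> / (\<zeta> - z)) i j - f z * hor (\<lambda>\<zeta>. 1 / (\<zeta> - z)) i j) \<le> \<epsilon>"
    if *: "\<And>\<zeta>. \<zeta> \<in> closed_segment (pt i j) (pt (Suc i) j) \<Longrightarrow> d \<le> cmod (\<zeta> - z) \<and> cmod (\<zeta> - z) \<le> 5 * d"
  proof -
    note int = cont[of "closed_segment (pt i j) (pt (Suc i) j)", OF *, THEN contour_integrable_continuous_linepath]
    have "cmod (hor (\<lambda>\<zeta>. f \<zeta> / (\<zeta> - z) - f z * (1 / (\<zeta> - z))) i j) \<le> \<epsilon> / d * d"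
      by (intro norm_hor_le cont bound *)
    moreover have "hor (\<lambda>\<zeta>. f \<zeta> / (\<zeta> - z) - f z * (1 / (\<zeta> - z))) i j =
        hor (\<lambda>\<zeta>. f \<zeta> / (\<zeta> - z)) i j - f z * hor (\<lambda>\<zeta>. 1 / (\<zeta> - z)) i j"
      using contour_integral_diff[OF int(1) int(3)] contour_integral_lmul[OF int(2), of "f z"]
      by (simp only: hor_def)
    ultimately show ?thesis using d_pos by simp
  qed
  show "cmod (ver (\<lambda>\<zeta>. f \<zeta> / (\<zeta> - z)) i j - f z * ver (\<lambda>\<zeta>. 1 / (\<zeta> - z)) i j) \<le> \<epsilon>"
    if *: "\<And>\<zeta>. \<zeta> \<in> closed_segment (pt i j) (pt i (Suc j)) \<Longrightarrow> d \<le> cmod (\<zeta> - z) \<and> cmod (\<zeta> - z) \<le> 5 * d"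
  proof -
    note int = cont[of "closed_segment (pt i j) (pt i (Suc j))", OF *, THEN contour_integrable_continuous_linepath]
    have "cmod (ver (\<lambda>\<zeta>. f \<zeta> / (\<zeta> - z) - f z * (1 / (\<zeta> - z))) i j) \<le> \<epsilon> / d * d"
      by (intro norm_ver_le cont bound *)
    moreover have "ver (\<lambda>\<zeta>. f \<zeta> / (\<zeta> - z) - f z * (1 / (\<zeta> - z))) i j =
        ver (\<lambda>\<zeta>. f \<zeta> / (\<zeta> - z)) i j - f z * ver (\<lambda>\<zeta>. 1 / (\<zeta> - z)) i j"
      using contour_integral_diff[OF int(1) int(3)] contour_integral_lmul[OF int(2), of "f z"]
      by (simp only: ver_def)
    ultimately show ?thesis using d_pos by simp
  qed
qed

text \<open>The point \<open>z\<close> sits in the middle cell of a block of three by three. An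
  outer edge is at least \<open>d\<close> away in one coordinate and at most \<open>2 * d\<close> in
  each, so \<open>5 * d\<close> is a generous upper bound.\<close>

lemma dist_to_block_edge:
  assumes x: "Re a + d * (real m + 1) \<le> Re z" "Re z \<le> Re a + d * (real m + 2)"
    and y: "Im a + d * (real k + 1) \<le> Im z" "Im z \<le> Im a + d * (real k + 2)"
  shows "\<lbrakk>m \<le> i; i < m + 3; j = k \<or> j = k + 3; \<zeta> \<in> closed_segment (pt i j) (pt (Suc i) j)\<rbrakk> \<Longrightarrow>
      d \<le> cmod (\<zeta> - z) \<and> cmod (\<zeta> - z) \<le> 5 * d"
    and "\<lbrakk>i = m \<or> i = m + 3; k \<le> j; j < k + 3; \<zeta> \<in> closed_segment (pt i j) (pt i (Suc j))\<rbrakk> \<Longrightarrow>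
      d \<le> cmod (\<zeta> - z) \<and> cmod (\<zeta> - z) \<le> 5 * d"
proof -
  have norm: "d \<le> cmod w \<and> cmod w \<le> 5 * d"
    if "\<bar>Re w\<bar> \<le> 2 * d" "\<bar>Im w\<bar> \<le> 2 * d" "d \<le> \<bar>Re w\<bar> \<or> d \<le> \<bar>Im w\<bar>" for w :: complex
    using that abs_Re_le_cmod[of w] abs_Im_le_cmod[of w] cmod_le[of w] d_pos by linarith
  note xy = x[unfolded distrib_left mult_1_right] y[unfolded distrib_left mult_1_right]
  have mono: "d * u \<le> d * v" if "u \<le> v" for u v :: real using that d_pos by simp
  show "d \<le> cmod (\<zeta> - z) \<and> cmod (\<zeta> - z) \<le> 5 * d"
    if *: "m \<le> i" "i < m + 3" "j = k \<or> j = k + 3" "\<zeta> \<in> closed_segment (pt i j) (pt (Suc i) j)"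
  proof (rule norm)
    have \<zeta>: "Im \<zeta> = Im a + d * real j" "Re a + d * real i \<le> Re \<zeta>" "Re \<zeta> \<le> Re a + d * real i + d"
      using *(4) d_pos by (auto simp: closed_segment_same_Im closed_segment_eq_real_ivl algebra_simps split: if_splits)
    have "d * real m \<le> d * real i" "d * (real i + 1) \<le> d * (real m + 3)"
      using * by (intro mono; simp)+
    then have i: "d * real m \<le> d * real i" "d * real i + d \<le> d * real m + d * 3"
      by (simp_all only: distrib_left mult_1_right)
    have "d * real j = d * real k \<or> d * real j = d * real k + d * 3"
      using *(3) by (auto simp: distrib_left)
    then show "\<bar>Re (\<zeta> - z)\<bar> \<le> 2 * d" "\<bar>Im (\<zeta> - z)\<bar> \<le> 2 * d"
        "d \<le> \<bar>Re (\<zeta> - z)\<bar> \<or> d \<le> \<bar>Im (\<zeta> - z)\<bar>"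
      using xy \<zeta> i d_pos unfolding minus_complex.sel by linarith+
  qed
  show "d \<le> cmod (\<zeta> - z) \<and> cmod (\<zeta> - z) \<le> 5 * d"
    if *: "i = m \<or> i = m + 3" "k \<le> j" "j < k + 3" "\<zeta> \<in> closed_segment (pt i j) (pt i (Suc j))"
  proof (rule norm)
    have \<zeta>: "Re \<zeta> = Re a + d * real i" "Im a + d * real j \<le> Im \<zeta>" "Im \<zeta> \<le> Im a + d * real j + d"
      using *(4) d_pos by (auto simp: closed_segment_same_Re closed_segment_eq_real_ivl algebra_simps split: if_splits)
    have "d * real k \<le> d * real j" "d * (real j + 1) \<le> d * (real k + 3)"
      using * by (intro mono; simp)+
    then have j: "d * real k \<le> d * real j" "d * real j + d \<le> d * real k + d * 3"
      by (simp_all only: distrib_left mult_1_right)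
    have "d * real i = d * real m \<or> d * real i = d * real m + d * 3"
      using *(1) by (auto simp: distrib_left)
    then show "\<bar>Re (\<zeta> - z)\<bar> \<le> 2 * d" "\<bar>Im (\<zeta> - z)\<bar> \<le> 2 * d"
        "d \<le> \<bar>Re (\<zeta> - z)\<bar> \<or> d \<le> \<bar>Im (\<zeta> - z)\<bar>"
      using xy \<zeta> j d_pos unfolding minus_complex.sel by linarith+
  qed
qed

text \<open>Freezing \<open>f\<close> at the value \<open>f z\<close> reduces the claim to
  \<open>block_boundary_inverse\<close>. The block has twelve outer edges, and each costs at most
  \<open>\<epsilon>\<close>.\<close>

lemma block_boundary_cauchy:
  assumes f: "continuous_on UNIV f" and \<epsilon>: "\<And>\<zeta>. cmod (\<zeta> - z) \<le> 5 * d \<Longrightarrow> cmod (f \<zeta> - f z) \<le> \<epsilon>"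
    and x: "Re a + d * (real m + 1) \<le> Re z" "Re z \<le> Re a + d * (real m + 2)"
    and y: "Im a + d * (real k + 1) \<le> Im z" "Im z \<le> Im a + d * (real k + 2)"
  shows "cmod (block_boundary (\<lambda>\<zeta>. f \<zeta> / (\<zeta> - z)) m (m + 3) k (k + 3) - 2 * of_real pi * \<i> * f z) \<le> 12 * \<epsilon>"
proof -
  let ?F = "\<lambda>\<zeta>. f \<zeta> / (\<zeta> - z)" and ?G = "\<lambda>\<zeta>. 1 / (\<zeta> - z)"
  define eh where "eh i j = hor ?F i j - f z * hor ?G i j" for i j
  define ev where "ev i j = ver ?F i j - f z * ver ?G i j" for i j
  have eh: "cmod (eh i j) \<le> \<epsilon>" if "m \<le> i" "i < m + 3" "j = k \<or> j = k + 3" for i j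
    unfolding eh_def using that by (intro norm_edge_cauchy_diff_le f \<epsilon> dist_to_block_edge(1)[OF x y])
  have ev: "cmod (ev i j) \<le> \<epsilon>" if "i = m \<or> i = m + 3" "k \<le> j" "j < k + 3" for i j
    unfolding ev_def using that by (intro norm_edge_cauchy_diff_le f \<epsilon> dist_to_block_edge(2)[OF x y])
  have "z \<in> box (pt m k) (pt (m + 3) (k + 3))"
    using x y d_pos by (auto simp: in_box_complex_iff algebra_simps)
  then have bG: "block_boundary ?G m (m + 3) k (k + 3) = 2 * of_real pi * \<i>"
    by (rule block_boundary_inverse)
  have "block_boundary ?F m (m + 3) k (k + 3) - f z * block_boundary ?G m (m + 3) k (k + 3) =
      (\<Sum>i=m..<m+3. eh i k - eh i (k + 3)) + (\<Sum>j=k..<k+3. ev (m + 3) j - ev m j)"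
    by (simp add: block_boundary_def eh_def ev_def sum_subtractf ring_distribs flip: sum_distrib_left)
  moreover have "cmod (\<Sum>i=m..<m+3. eh i k - eh i (k + 3)) \<le> of_nat (card {m..<m+3}) * (2 * \<epsilon>)"
  proof (rule sum_norm_bound)
    fix i assume "i \<in> {m..<m+3}"
    then show "cmod (eh i k - eh i (k + 3)) \<le> 2 * \<epsilon>"
      using eh[of i k] eh[of i "k+3"] norm_triangle_ineq4[of "eh i k" "eh i (k+3)"] by simp
  qed
  moreover have "cmod (\<Sum>j=k..<k+3. ev (m + 3) j - ev m j) \<le> of_nat (card {k..<k+3}) * (2 * \<epsilon>)"
  proof (rule sum_norm_bound)
    fix j assume "j \<in> {k..<k+3}"
    then show "cmod (ev (m + 3) j - ev m j) \<le> 2 * \<epsilon>"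
      using ev[of m j] ev[of "m+3" j] norm_triangle_ineq4[of "ev (m+3) j" "ev m j"] by simp
  qed
  ultimately have "cmod (block_boundary ?F m (m + 3) k (k + 3) - f z * block_boundary ?G m (m + 3) k (k + 3)) \<le> 12 * \<epsilon>"
    using norm_triangle_ineq[of "\<Sum>i=m..<m+3. eh i k - eh i (k + 3)" "\<Sum>j=k..<k+3. ev (m + 3) j - ev m j"]
    by simp
  then show ?thesis unfolding bG by (simp add: mult.commute)
qed

end

section \<open>Mergelyan's theorem\<close>

definition decay_sum :: real where
  "decay_sum = (\<Sum>k. (1 + real k) powr (-3/2))"

lemma summable_decay: "summable (\<lambda>k. (1 + real k) powr (-3/2))"
proof -
  have "summable (\<lambda>k. real k powr (-3/2))" by (subst summable_real_powr_iff) simp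
  then have "summable (\<lambda>k. real (Suc k) powr (-3/2))" by (subst summable_Suc_iff)
  then show ?thesis by simp
qed

text \<open>On either side of \<open>p\<close> the offsets are distinct naturals, so each half is
  dominated by the full series.\<close>

lemma sum_decay_le:
  "(\<Sum>i<n. (1 + \<bar>real i - real p\<bar>) powr (-3/2)) \<le> 2 * decay_sum"
proof -
  let ?w = "\<lambda>k::nat. (1 + real k) powr (-3/2)"
  have fin: "sum ?w A \<le> decay_sum" if "finite A" for A
    unfolding decay_sum_def by (rule sum_le_suminf[OF summable_decay that]) simp
  have "(\<Sum>i<n. (1 + \<bar>real i - real p\<bar>) powr (-3/2)) \<le>
      (\<Sum>i\<in>{..<p} \<union> {p..<p+n}. (1 + \<bar>real i - real p\<bar>) powr (-3/2))"
    by (rule sum_mono2) auto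
  also have "\<dots> = (\<Sum>i<p. (1 + \<bar>real i - real p\<bar>) powr (-3/2)) +
      (\<Sum>i=p..<p+n. (1 + \<bar>real i - real p\<bar>) powr (-3/2))"
    by (rule sum.union_disjoint) auto
  also have "(\<Sum>i<p. (1 + \<bar>real i - real p\<bar>) powr (-3/2)) = (\<Sum>i<p. ?w (p - i))"
    by (intro sum.cong) (auto simp: of_nat_diff)
  also have "\<dots> = sum ?w ((\<lambda>i. p - i) ` {..<p})"
    by (subst sum.reindex) (auto simp: inj_on_def)
  also have "(\<Sum>i=p..<p+n. (1 + \<bar>real i - real p\<bar>) powr (-3/2)) = (\<Sum>i=p..<p+n. ?w (i - p))"
    by (intro sum.cong) (auto simp: of_nat_diff)
  also have "\<dots> = sum ?w ((\<lambda>i. i - p) ` {p..<p+n})"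
    by (subst sum.reindex) (auto simp: inj_on_def)
  finally show ?thesis using fin[of "(\<lambda>i. p - i) ` {..<p}"] fin[of "(\<lambda>i. i - p) ` {p..<p+n}"] by simp
qed

text \<open>The cube is shared between the coordinates: \<open>(1 + max A B) ^ 3\<close> dominates
  the product of the powers 3/2 of \<open>1 + A\<close> and \<open>1 + B\<close>. The double sum
  over the grid thus factors into two convergent sums. The 27 comes from
  \<open>k - 1 \<ge> (1 + k) / 3\<close> for \<open>k \<ge> 2\<close>.\<close>

lemma cubic_decay:
  fixes A B D d :: real
  assumes d: "d > 0" and AB: "A \<ge> 0" "B \<ge> 0" "A \<ge> 2 \<or> B \<ge> 2"
    and D: "d * (A - 1) \<le> D" "d * (B - 1) \<le> D"
  shows "d \<le> D" "1 / D ^ 3 \<le> 27 / d ^ 3 * ((1 + A) powr (-3/2) * (1 + B) powr (-3/2))"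
proof -
  define k where "k = max A B"
  have k: "k \<ge> 2" "A \<le> k" "B \<le> k" "d * (k - 1) \<le> D" using AB D by (auto simp: k_def max_def)
  have "d * 1 \<le> d * (k - 1)" using d k(1) by (intro mult_left_mono) auto
  then show "d \<le> D" using k(4) by simp
  have "d * ((1 + k) / 3) \<le> d * (k - 1)" using d k(1) by (intro mult_left_mono) auto
  then have "d * ((1 + k) / 3) \<le> D" using k(4) by simp
  then have "(d * ((1 + k) / 3)) ^ 3 \<le> D ^ 3" using d k by (intro power_mono) auto
  then have "1 / D ^ 3 \<le> 1 / (d * ((1 + k) / 3)) ^ 3" using d k by (intro frac_le) auto
  also have "\<dots> = 27 / d ^ 3 * (1 / (1 + k) ^ 3)" by (simp add: power_mult_distrib power_divide)
  also have "1 / (1 + k) ^ 3 = (1 + k) powr (- 3)"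
    using k by (simp add: powr_minus powr_numeral divide_inverse)
  also have "\<dots> = (1 + k) powr (-3/2) * (1 + k) powr (-3/2)"
    by (simp flip: powr_add)
  also have "27 / d ^ 3 * \<dots> \<le> 27 / d ^ 3 * ((1 + A) powr (-3/2) * (1 + B) powr (-3/2))"
    using d k AB by (intro mult_left_mono mult_mono powr_mono2') auto
  finally show "1 / D ^ 3 \<le> 27 / d ^ 3 * ((1 + A) powr (-3/2) * (1 + B) powr (-3/2))"
    by simp
qed

lemma kernel_const_pos: "kernel_const > 0" by (simp add: kernel_const_def)

text \<open>The summands belong to the boundary of the block around \<open>z\<close>, to the
  substitute kernels on its nine cells, and to the kernel errors on all other cells.\<close>

definition approximation_const :: real where
  "approximation_const = 12 + 12 * kernel_const + 972 * kernel_const * (2 * decay_sum)\<^sup>2"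

section \<open>Replacing the Cauchy kernel cell by cell\<close>

context square_grid
begin

lemma cell_distance:
  assumes \<zeta>: "\<zeta> \<in> cell i j"
    and x: "Re a + d * real p \<le> Re z" "Re z \<le> Re a + d * (real p + 1)"
    and y: "Im a + d * real q \<le> Im z" "Im z \<le> Im a + d * (real q + 1)"
  shows "d * (\<bar>real i - real p\<bar> - 1) \<le> cmod (z - \<zeta>)" "d * (\<bar>real j - real q\<bar> - 1) \<le> cmod (z - \<zeta>)"
proof -
  have c: "Re a + d * real i \<le> Re \<zeta>" "Re \<zeta> \<le> Re a + d * real i + d"
     "Im a + d * real j \<le> Im \<zeta>" "Im \<zeta> \<le> Im a + d * real j + d"
    using \<zeta> by (auto simp: cell_def in_cbox_complex_iff algebra_simps)
  note xy = x[unfolded distrib_left mult_1_right] y[unfolded distrib_left mult_1_right]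
  have "d * (\<bar>real i - real p\<bar> - 1) \<le> \<bar>Re (z - \<zeta>)\<bar>"
    using xy c unfolding minus_complex.sel by (cases "i \<le> p") (auto simp: algebra_simps)
  then show "d * (\<bar>real i - real p\<bar> - 1) \<le> cmod (z - \<zeta>)" using abs_Re_le_cmod order_trans by blast
  have "d * (\<bar>real j - real q\<bar> - 1) \<le> \<bar>Im (z - \<zeta>)\<bar>"
    using xy c unfolding minus_complex.sel by (cases "j \<le> q") (auto simp: algebra_simps)
  then show "d * (\<bar>real j - real q\<bar> - 1) \<le> cmod (z - \<zeta>)" using abs_Im_le_cmod order_trans by blast
qed

lemma cell_diameter:
  assumes "\<zeta> \<in> cell i j" "\<xi> \<in> cell i j"
  shows "cmod (\<zeta> - \<xi>) \<le> 2 * d"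
proof -
  have "\<bar>Re (\<zeta> - \<xi>)\<bar> \<le> d" "\<bar>Im (\<zeta> - \<xi>)\<bar> \<le> d"
    using assms by (auto simp: cell_def in_cbox_complex_iff algebra_simps)
  then show ?thesis using cmod_le[of "\<zeta> - \<xi>"] by linarith
qed

text \<open>A cell not inside \<open>interior K\<close> meets the closure of \<open>- K\<close>, so
  some \<open>x\<close> off \<open>K\<close> is within \<open>d\<close> of it. As the diameter is at
  most \<open>2 * d\<close>, the disc of radius \<open>r = 3 * d\<close> about \<open>x\<close>
  covers the cell; \<open>r / 3\<close> is then the mesh, and the factor 9 is
  \<open>r\<^sup>2 / d\<^sup>2\<close>.\<close>

lemma cell_kernel:
  assumes K: "compact K" "connected (- K)" and bad: "\<not> cell i j \<subseteq> interior K"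
  shows "\<exists>g m. poly_limit_on K g \<and> (\<forall>z\<in>K. \<forall>\<zeta>\<in>cell i j.
     cmod (g z + (\<zeta> - m) * (g z)\<^sup>2) \<le> kernel_const / (3 * d) \<and>
     (d \<le> cmod (z - \<zeta>) \<longrightarrow> cmod (g z + (\<zeta> - m) * (g z)\<^sup>2 - 1 / (z - \<zeta>)) \<le> 9 * kernel_const * d\<^sup>2 / cmod (z - \<zeta>) ^ 3))"
proof -
  obtain w where w: "w \<in> cell i j" "w \<notin> interior K" using bad by blast
  then have "w \<in> closure (- K)" by (simp add: closure_complement)
  then obtain x where x: "x \<notin> K" "dist x w < d"
    using d_pos unfolding closure_approachable by auto
  have sub: "cell i j \<subseteq> ball x (3 * d)"
  proof
    fix \<zeta> assume "\<zeta> \<in> cell i j"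
    then have "dist w \<zeta> \<le> 2 * d" using cell_diameter[OF w(1)] by (simp add: dist_norm)
    then show "\<zeta> \<in> ball x (3 * d)" using x(2) dist_triangle[of x \<zeta> w] by simp
  qed
  obtain g m where g: "poly_limit_on K g"
    "\<And>z \<zeta>. \<lbrakk>z \<in> K; \<zeta> \<in> ball x (3 * d)\<rbrakk> \<Longrightarrow> cmod (g z + (\<zeta> - m) * (g z)\<^sup>2) \<le> kernel_const / (3 * d)"
    "\<And>z \<zeta>. \<lbrakk>z \<in> K; \<zeta> \<in> ball x (3 * d); 3 * d / 3 \<le> cmod (z - \<zeta>)\<rbrakk> \<Longrightarrow>
      cmod (g z + (\<zeta> - m) * (g z)\<^sup>2 - 1 / (z - \<zeta>)) \<le> kernel_const * (3 * d)\<^sup>2 / cmod (z - \<zeta>) ^ 3"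
    using approximate_cauchy_kernel[OF K x(1), of "3 * d"] d_pos by (metis mult_pos_pos zero_less_numeral)
  have sq: "kernel_const * (3 * d)\<^sup>2 = 9 * kernel_const * d\<^sup>2" by (simp add: power_mult_distrib)
  show ?thesis
    using g(1) g(2) g(3)[unfolded sq] sub by (intro exI[of _ g] exI[of _ m]) auto
qed

lemma outer_boundary_zero:
  assumes "\<And>\<zeta>. \<zeta> \<notin> box (pt 0 0) (pt n n) \<Longrightarrow> h \<zeta> = 0"
  shows "block_boundary h 0 n 0 n = 0"
proof -
  have hor: "hor h i j = 0" if "j = 0 \<or> j = n" for i j
  proof -
    have 0: "h \<zeta> = 0" if "\<zeta> \<in> closed_segment (pt i j) (pt (Suc i) j)" for \<zeta>
      using that \<open>j = 0 \<or> j = n\<close> by (intro assms) (auto simp: in_box_complex_iff closed_segment_same_Im)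
    then have "cmod (hor h i j) \<le> 0 * d" by (intro norm_hor_le) (auto cong: continuous_on_cong)
    then show ?thesis by simp
  qed
  have ver: "ver h i j = 0" if "i = 0 \<or> i = n" for i j
  proof -
    have 0: "h \<zeta> = 0" if "\<zeta> \<in> closed_segment (pt i j) (pt i (Suc j))" for \<zeta>
      using that \<open>i = 0 \<or> i = n\<close> by (intro assms) (auto simp: in_box_complex_iff closed_segment_same_Re)
    then have "cmod (ver h i j) \<le> 0 * d" by (intro norm_ver_le) (auto cong: continuous_on_cong)
    then show ?thesis by simp
  qed
  show ?thesis by (simp add: block_boundary_def hor ver)
qed

text \<open>The substitute kernel is a polynomial in \<open>\<zeta>\<close>, so by Cauchy the
  constant \<open>c\<close> can be subtracted for free. The left side is suited to estimates by the
  oscillation of \<open>f\<close>; on the right, \<open>z\<close> will enter only through the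
  coefficients \<open>u\<close> and \<open>v\<close>.\<close>

lemma sqint_kernel:
  assumes f: "continuous_on UNIV f"
  shows "sqint (\<lambda>\<zeta>. (f \<zeta> - c) * (u + (\<zeta> - m) * v)) i j =
    u * sqint f i j + v * sqint (\<lambda>\<zeta>. (\<zeta> - m) * f \<zeta>) i j"
proof -
  have fc: "continuous_on (cell i j) f" using f continuous_on_subset by blast
  have "sqint (\<lambda>\<zeta>. (f \<zeta> - c) * (u + (\<zeta> - m) * v)) i j =
      sqint (\<lambda>\<zeta>. (u * f \<zeta> + v * ((\<zeta> - m) * f \<zeta>)) + (- c) * (u + (\<zeta> - m) * v)) i j"
    by (simp add: algebra_simps)
  also have "\<dots> = u * sqint f i j + v * sqint (\<lambda>\<zeta>. (\<zeta> - m) * f \<zeta>) i j +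
      sqint (\<lambda>\<zeta>. (- c) * (u + (\<zeta> - m) * v)) i j"
    by (subst sqint_add sqint_lmul; (intro continuous_intros fc)?)+ simp
  also have "sqint (\<lambda>\<zeta>. (- c) * (u + (\<zeta> - m) * v)) i j = 0"
    by (rule sqint_holomorphic[of _ UNIV]) (auto intro!: holomorphic_intros)
  finally show ?thesis by simp
qed

lemma sqint_kernel_error:
  assumes f: "continuous_on UNIV f" and z: "z \<notin> cell i j"
  shows "sqint (\<lambda>\<zeta>. (f \<zeta> - c) * (u + (\<zeta> - m) * v - 1 / (z - \<zeta>))) i j =
    u * sqint f i j + v * sqint (\<lambda>\<zeta>. (\<zeta> - m) * f \<zeta>) i j + sqint (\<lambda>\<zeta>. f \<zeta> / (\<zeta> - z)) i j"
proof -
  have fc: "continuous_on (cell i j) f" using f continuous_on_subset by blast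
  \<comment> \<open>At \<open>\<zeta> = z\<close> all the fractions are 0 by convention, so the
    identity holds there too. The sign change between \<open>z - \<zeta>\<close> and
    \<open>\<zeta> - z\<close> accounts for the plus sign in the conclusion.\<close>
  have eq: "(f \<zeta> - c) * (u + (\<zeta> - m) * v - 1 / (z - \<zeta>)) =
      (f \<zeta> - c) * (u + (\<zeta> - m) * v) + (f \<zeta> / (\<zeta> - z) + (- c) * (1 / (\<zeta> - z)))" for \<zeta>
    by (cases "z = \<zeta>") (auto simp: divide_simps, simp add: algebra_simps)
  have nz: "\<zeta> - z \<noteq> 0" if "\<zeta> \<in> cell i j" for \<zeta> using that z by auto
  have c1: "continuous_on (cell i j) (\<lambda>\<zeta>. f \<zeta> / (\<zeta> - z))" "continuous_on (cell i j) (\<lambda>\<zeta>. (- c) * (1 / (\<zeta> - z)))"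
    using nz by (auto intro!: continuous_intros fc)
  have c2: "continuous_on (cell i j) (\<lambda>\<zeta>. (f \<zeta> - c) * (u + (\<zeta> - m) * v))"
    by (intro continuous_intros fc)
  have "sqint (\<lambda>\<zeta>. (- c) * (1 / (\<zeta> - z))) i j = 0"
    by (rule sqint_holomorphic[of _ "- {z}"]) (use z in \<open>auto intro!: holomorphic_intros\<close>)
  then show ?thesis
    unfolding eq sqint_add[OF c2 continuous_on_add[OF c1]] sqint_add[OF c1] sqint_kernel[OF f] by simp
qed

lemma grid_approximation:
  assumes K: "compact K" "connected (- K)"
    and f: "continuous_on UNIV f" "f holomorphic_on interior K"
    and \<epsilon>: "\<And>x y. cmod (x - y) \<le> 5 * d \<Longrightarrow> cmod (f x - f y) \<le> \<epsilon>"
    and supp: "\<And>\<zeta>. \<zeta> \<notin> box (pt 0 0) (pt (Suc n) (Suc n)) \<Longrightarrow> f \<zeta> = 0"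
    and inner: "K \<subseteq> box (pt 1 1) (pt n n)"
  shows "\<exists>F. poly_limit_on K F \<and> (\<forall>z\<in>K. cmod (F z - f z) \<le> approximation_const * \<epsilon>)"
proof -
  define bad where "bad i j \<longleftrightarrow> \<not> cell i j \<subseteq> interior K" for i j
  have "\<forall>i j. \<exists>g m. bad i j \<longrightarrow> poly_limit_on K g \<and> (\<forall>z\<in>K. \<forall>\<zeta>\<in>cell i j.
     cmod (g z + (\<zeta> - m) * (g z)\<^sup>2) \<le> kernel_const / (3 * d) \<and>
     (d \<le> cmod (z - \<zeta>) \<longrightarrow> cmod (g z + (\<zeta> - m) * (g z)\<^sup>2 - 1 / (z - \<zeta>)) \<le> 9 * kernel_const * d\<^sup>2 / cmod (z - \<zeta>) ^ 3))"
    using cell_kernel[OF K] unfolding bad_def by blast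
  then obtain g m where gm: "\<And>i j. bad i j \<Longrightarrow> poly_limit_on K (g i j)"
     "\<And>i j z \<zeta>. \<lbrakk>bad i j; z \<in> K; \<zeta> \<in> cell i j\<rbrakk> \<Longrightarrow> cmod (g i j z + (\<zeta> - m i j) * (g i j z)\<^sup>2) \<le> kernel_const / (3 * d)"
     "\<And>i j z \<zeta>. \<lbrakk>bad i j; z \<in> K; \<zeta> \<in> cell i j; d \<le> cmod (z - \<zeta>)\<rbrakk> \<Longrightarrow>
        cmod (g i j z + (\<zeta> - m i j) * (g i j z)\<^sup>2 - 1 / (z - \<zeta>)) \<le> 9 * kernel_const * d\<^sup>2 / cmod (z - \<zeta>) ^ 3"
    by metis
  \<comment> \<open>On a bad cell this stands in for the integral of
    \<open>f \<zeta> / (z - \<zeta>)\<close>, that is, for minus the integral of \<open>h\<close>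
    below. The values of \<open>sqint\<close> do not depend on \<open>z\<close>, so \<open>T\<close>
    inherits approximability from \<open>g\<close>.\<close>
  define T where "T z = (\<lambda>(i, j). if bad i j then g i j z * sqint f i j + (g i j z)\<^sup>2 * sqint (\<lambda>\<zeta>. (\<zeta> - m i j) * f \<zeta>) i j else 0)" for z
  define I where "I = {0..<Suc n} \<times> {0..<Suc n}"
  define F where "F z = 1 / (2 * of_real pi * \<i>) * (\<Sum>c\<in>I. T z c)" for z
  have fc: "continuous_on S f" for S using f(1) continuous_on_subset by blast
  have T_lim: "poly_limit_on K (\<lambda>z. T z c)" for c
  proof (cases c)
    case (Pair i j)
    show ?thesis
    proof (cases "bad i j")
      case True
      then show ?thesis unfolding Pair T_def
        by (auto intro!: poly_limit_on_add poly_limit_on_mult poly_limit_on_const poly_limit_on_power gm K)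
    next
      case False
      then show ?thesis unfolding Pair T_def by (auto intro: poly_limit_on_const)
    qed
  qed
  have "poly_limit_on K F" unfolding F_def
    by (intro poly_limit_on_mult K poly_limit_on_const poly_limit_on_sum T_lim)
  moreover have "cmod (F z - f z) \<le> approximation_const * \<epsilon>" if z: "z \<in> K" for z
  proof -
    have \<epsilon>0: "\<epsilon> \<ge> 0" using \<epsilon>[of 0 0] d_pos by simp
    define h where "h \<zeta> = f \<zeta> / (\<zeta> - z)" for \<zeta>
    \<comment> \<open>The index is one less than the floor, which places \<open>z\<close> in the
      middle cell of the block; the last conjunct keeps the block inside the grid.\<close>
    have loc: "\<exists>m. real m + 1 \<le> x \<and> x \<le> real m + 2 \<and> m + 3 \<le> Suc n" if "1 < x" "x < real n" for x
    proof -
      have f1: "\<lfloor>x\<rfloor> \<ge> 1" "\<lfloor>x\<rfloor> < int n" using that by linarith+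
      then have "real (nat (\<lfloor>x\<rfloor> - 1)) = of_int \<lfloor>x\<rfloor> - 1" by simp
      moreover have "nat (\<lfloor>x\<rfloor> - 1) + 3 \<le> Suc n" using f1 by linarith
      ultimately show ?thesis by (intro exI[of _ "nat (\<lfloor>x\<rfloor> - 1)"]) linarith
    qed
    have "z \<in> box (pt 1 1) (pt n n)" using inner z by blast
    then have "1 < (Re z - Re a) / d" "(Re z - Re a) / d < real n" "1 < (Im z - Im a) / d" "(Im z - Im a) / d < real n"
      using d_pos by (auto simp: in_box_complex_iff field_simps)
    then obtain k l where kl: "real k + 1 \<le> (Re z - Re a) / d" "(Re z - Re a) / d \<le> real k + 2" "k + 3 \<le> Suc n"
        "real l + 1 \<le> (Im z - Im a) / d" "(Im z - Im a) / d \<le> real l + 2" "l + 3 \<le> Suc n"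
      using loc by meson
    then have xy: "Re a + d * (real k + 1) \<le> Re z" "Re z \<le> Re a + d * (real k + 2)"
        "Im a + d * (real l + 1) \<le> Im z" "Im z \<le> Im a + d * (real l + 2)"
      using d_pos by (auto simp: field_simps)
    define N where "N = {k..<k+3} \<times> {l..<l+3}"
    define W where "W p i = (1 + \<bar>real i - real p\<bar>) powr (-3/2)" for p i :: nat
    have NI: "N \<subseteq> I" "finite I" using kl by (auto simp: N_def I_def)
    have prod: "(\<Sum>c\<in>A \<times> B. sqint h (fst c) (snd c)) = (\<Sum>i\<in>A. \<Sum>j\<in>B. sqint h i j)" for A B
      by (simp add: sum.cartesian_product case_prod_unfold)
    have "(\<Sum>c\<in>I. sqint h (fst c) (snd c)) = block_boundary h 0 (Suc n) 0 (Suc n)"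
      unfolding I_def prod by (rule sum_sqint) auto
    also have "\<dots> = 0" by (rule outer_boundary_zero) (simp add: h_def supp)
    finally have sumI: "(\<Sum>c\<in>I. sqint h (fst c) (snd c)) = 0" .
    have "(\<Sum>c\<in>N. sqint h (fst c) (snd c)) = block_boundary h k (k + 3) l (l + 3)"
      unfolding N_def prod by (rule sum_sqint) auto
    then have sumN: "cmod ((\<Sum>c\<in>N. sqint h (fst c) (snd c)) - 2 * of_real pi * \<i> * f z) \<le> 12 * \<epsilon>"
      unfolding h_def using block_boundary_cauchy[OF f(1) \<epsilon> xy] by simp
    have osc: "cmod (f \<zeta> - f (pt i j)) \<le> \<epsilon>" if "\<zeta> \<in> cell i j" for \<zeta> i j
      using cell_diameter[OF that pt_in_cell(1)] d_pos by (intro \<epsilon>) linarith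
    \<comment> \<open>On the block the substitute need not be close to the Cauchy kernel; its
      contribution is simply small. This will be summed over only the nine cells of
      \<open>N\<close>.\<close>
    have near: "cmod (T z c) \<le> 4 / 3 * kernel_const * \<epsilon>" for c
    proof (cases c)
      case (Pair i j)
      show ?thesis
      proof (cases "bad i j")
        case True
        define Q where "Q \<zeta> = g i j z + (\<zeta> - m i j) * (g i j z)\<^sup>2" for \<zeta>
        have "T z c = sqint (\<lambda>\<zeta>. (f \<zeta> - f (pt i j)) * Q \<zeta>) i j"
          using True by (simp add: Pair T_def Q_def sqint_kernel[OF f(1)])
        also have "cmod \<dots> \<le> 4 * d * (\<epsilon> * (kernel_const / (3 * d)))"
        proof (rule norm_sqint_le)
          show "continuous_on (cell i j) (\<lambda>\<zeta>. (f \<zeta> - f (pt i j)) * Q \<zeta>)"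
            unfolding Q_def by (intro continuous_intros fc)
          show "cmod ((f \<zeta> - f (pt i j)) * Q \<zeta>) \<le> \<epsilon> * (kernel_const / (3 * d))" if "\<zeta> \<in> cell i j" for \<zeta>
            unfolding norm_mult Q_def using osc[OF that] gm(2)[OF True z that] \<epsilon>0
            by (intro mult_mono) auto
        qed
        also have "\<dots> = 4 / 3 * kernel_const * \<epsilon>" using d_pos by simp
        finally show ?thesis .
      next
        case False
        then show ?thesis using \<epsilon>0 kernel_const_pos by (simp add: Pair T_def)
      qed
    qed
    \<comment> \<open>The cell of \<open>z\<close> has indices \<open>Suc k\<close> and
      \<open>Suc l\<close>, and a cell off the block differs from it by at least 2 in one index. The
      constant 972 is \<open>4 * 9 * 27\<close>, and all powers of \<open>d\<close> cancel.\<close>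
    have far: "cmod (T z c + sqint h (fst c) (snd c)) \<le> 972 * kernel_const * \<epsilon> * (W (Suc k) (fst c) * W (Suc l) (snd c))"
      if c: "c \<in> I - N" for c
    proof (cases c)
      case (Pair i j)
      have dist: "d \<le> cmod (z - \<zeta>)" "1 / cmod (z - \<zeta>) ^ 3 \<le> 27 / d ^ 3 * (W (Suc k) i * W (Suc l) j)"
        if \<zeta>: "\<zeta> \<in> cell i j" for \<zeta>
      proof -
        have "\<bar>real i - real (Suc k)\<bar> \<ge> 2 \<or> \<bar>real j - real (Suc l)\<bar> \<ge> 2"
          using c unfolding Pair N_def by auto
        moreover have "d * (\<bar>real i - real (Suc k)\<bar> - 1) \<le> cmod (z - \<zeta>)"
            "d * (\<bar>real j - real (Suc l)\<bar> - 1) \<le> cmod (z - \<zeta>)"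
          using cell_distance[OF \<zeta>, of "Suc k" z "Suc l"] xy by (auto simp: add.commute)
        ultimately show "d \<le> cmod (z - \<zeta>)" "1 / cmod (z - \<zeta>) ^ 3 \<le> 27 / d ^ 3 * (W (Suc k) i * W (Suc l) j)"
          unfolding W_def using cubic_decay[OF d_pos, of "\<bar>real i - real (Suc k)\<bar>" "\<bar>real j - real (Suc l)\<bar>" "cmod (z - \<zeta>)"]
          by auto
      qed
      have zc: "z \<notin> cell i j" using dist(1)[of z] d_pos by auto
      show ?thesis
      proof (cases "bad i j")
        case True
        define Q where "Q \<zeta> = g i j z + (\<zeta> - m i j) * (g i j z)\<^sup>2 - 1 / (z - \<zeta>)" for \<zeta>
        have "T z c + sqint h (fst c) (snd c) = sqint (\<lambda>\<zeta>. (f \<zeta> - f (pt i j)) * Q \<zeta>) i j"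
          using True by (simp add: Pair T_def Q_def h_def[abs_def] sqint_kernel_error[OF f(1) zc])
        also have "cmod \<dots> \<le> 4 * d * (\<epsilon> * (9 * kernel_const * d\<^sup>2 * (27 / d ^ 3 * (W (Suc k) i * W (Suc l) j))))"
        proof (rule norm_sqint_le)
          show "continuous_on (cell i j) (\<lambda>\<zeta>. (f \<zeta> - f (pt i j)) * Q \<zeta>)"
            unfolding Q_def using zc by (intro continuous_intros fc) auto
          fix \<zeta> assume \<zeta>: "\<zeta> \<in> cell i j"
          have "cmod (Q \<zeta>) \<le> 9 * kernel_const * d\<^sup>2 * (1 / cmod (z - \<zeta>) ^ 3)"
            unfolding Q_def using gm(3)[OF True z \<zeta> dist(1)[OF \<zeta>]] by simp
          also have "\<dots> \<le> 9 * kernel_const * d\<^sup>2 * (27 / d ^ 3 * (W (Suc k) i * W (Suc l) j))"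
            using kernel_const_pos by (intro mult_left_mono dist(2)[OF \<zeta>]) auto
          finally show "cmod ((f \<zeta> - f (pt i j)) * Q \<zeta>) \<le> \<epsilon> * (9 * kernel_const * d\<^sup>2 * (27 / d ^ 3 * (W (Suc k) i * W (Suc l) j)))"
            unfolding norm_mult using osc[OF \<zeta>] \<epsilon>0 by (intro mult_mono) auto
        qed
        also have "\<dots> = 972 * kernel_const * \<epsilon> * (W (Suc k) i * W (Suc l) j)"
          using d_pos by (simp add: power2_eq_square power3_eq_cube)
        finally show ?thesis by (simp add: Pair)
      next
        case False
        \<comment> \<open>A good cell off the block costs nothing: \<open>T\<close> is 0 there by
          definition and the integral of \<open>h\<close> vanishes by Cauchy.\<close>
        have "h holomorphic_on interior K - {z}"
          unfolding h_def by (intro holomorphic_intros holomorphic_on_subset[OF f(2)]) auto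
        moreover have "cell i j \<subseteq> interior K - {z}" using False zc unfolding bad_def by blast
        ultimately have "sqint h i j = 0"
          using sqint_holomorphic[of h "interior K - {z}" i j] by (simp add: open_Diff)
        moreover have "W (Suc k) i * W (Suc l) j \<ge> 0" by (simp add: W_def)
        ultimately show ?thesis using False \<epsilon>0 kernel_const_pos by (simp add: Pair T_def)
      qed
    qed
    \<comment> \<open>Adding the vanishing total \<open>sumI\<close> isolates the sum of
      \<open>sqint h\<close> over the block, which is the term that reproduces
      \<open>f z\<close>.\<close>
    have sI: "(\<Sum>c\<in>I. T z c) = (\<Sum>c\<in>I - N. T z c + sqint h (fst c) (snd c)) + (\<Sum>c\<in>N. T z c) + (\<Sum>c\<in>N. sqint h (fst c) (snd c))"
    proof -
      have "(\<Sum>c\<in>I. T z c) = (\<Sum>c\<in>I. T z c + sqint h (fst c) (snd c))"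
        by (simp add: sum.distrib sumI)
      also have "\<dots> = (\<Sum>c\<in>I - N. T z c + sqint h (fst c) (snd c)) + (\<Sum>c\<in>N. T z c + sqint h (fst c) (snd c))"
        by (rule sum.subset_diff[OF NI])
      finally show ?thesis by (simp add: sum.distrib)
    qed
    have 1: "cmod (\<Sum>c\<in>I - N. T z c + sqint h (fst c) (snd c)) \<le> 972 * kernel_const * (2 * decay_sum)\<^sup>2 * \<epsilon>"
    proof -
      have "cmod (\<Sum>c\<in>I - N. T z c + sqint h (fst c) (snd c)) \<le>
          (\<Sum>c\<in>I - N. 972 * kernel_const * \<epsilon> * (W (Suc k) (fst c) * W (Suc l) (snd c)))"
        by (rule sum_norm_le) (rule far)
      also have "\<dots> \<le> (\<Sum>c\<in>I. 972 * kernel_const * \<epsilon> * (W (Suc k) (fst c) * W (Suc l) (snd c)))"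
        using NI \<epsilon>0 kernel_const_pos by (intro sum_mono2) (auto simp: W_def)
      also have "\<dots> = 972 * kernel_const * \<epsilon> * (\<Sum>c\<in>I. W (Suc k) (fst c) * W (Suc l) (snd c))"
        by (rule sum_distrib_left[symmetric])
      also have "(\<Sum>c\<in>I. W (Suc k) (fst c) * W (Suc l) (snd c)) = (\<Sum>i<Suc n. W (Suc k) i) * (\<Sum>j<Suc n. W (Suc l) j)"
        by (simp only: I_def atLeast0LessThan sum_product sum.cartesian_product case_prod_unfold)
      also have "972 * kernel_const * \<epsilon> * \<dots> \<le> 972 * kernel_const * \<epsilon> * ((2 * decay_sum) * (2 * decay_sum))"
      proof (intro mult_left_mono mult_mono)
        have s: "(\<Sum>i<Suc n. W p i) \<le> 2 * decay_sum" for p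
          unfolding W_def by (rule sum_decay_le)
        then show "(\<Sum>i<Suc n. W (Suc k) i) \<le> 2 * decay_sum" "(\<Sum>i<Suc n. W (Suc l) i) \<le> 2 * decay_sum" by auto
        show "0 \<le> (\<Sum>i<Suc n. W (Suc l) i)" by (intro sum_nonneg) (simp add: W_def)
        show "0 \<le> 2 * decay_sum"
          by (rule order_trans[OF _ s[of 0]]) (intro sum_nonneg, simp add: W_def)
      qed (use \<epsilon>0 kernel_const_pos in auto)
      finally show ?thesis by (simp add: power2_eq_square mult_ac)
    qed
    have "cmod (\<Sum>c\<in>N. T z c) \<le> of_nat (card N) * (4 / 3 * kernel_const * \<epsilon>)"
      by (rule sum_norm_bound) (rule near)
    then have 2: "cmod (\<Sum>c\<in>N. T z c) \<le> 12 * kernel_const * \<epsilon>" by (simp add: N_def)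
    have "2 * of_real pi * \<i> * (F z - f z) = (\<Sum>c\<in>I. T z c) - 2 * of_real pi * \<i> * f z"
      by (simp add: F_def right_diff_distrib)
    also have "cmod \<dots> \<le> 972 * kernel_const * (2 * decay_sum)\<^sup>2 * \<epsilon> + 12 * kernel_const * \<epsilon> + 12 * \<epsilon>"
    proof -
      have "(\<Sum>c\<in>I. T z c) - 2 * of_real pi * \<i> * f z = (\<Sum>c\<in>I - N. T z c + sqint h (fst c) (snd c)) +
         (\<Sum>c\<in>N. T z c) + ((\<Sum>c\<in>N. sqint h (fst c) (snd c)) - 2 * of_real pi * \<i> * f z)"
        unfolding sI by simp
      then show ?thesis using 1 2 sumN by (metis (no_types, lifting) norm_triangle_mono)
    qed
    also have "\<dots> = approximation_const * \<epsilon>" by (simp add: approximation_const_def algebra_simps)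
    finally have "2 * pi * cmod (F z - f z) \<le> approximation_const * \<epsilon>" by (simp add: norm_mult)
    moreover have "1 * cmod (F z - f z) \<le> 2 * pi * cmod (F z - f z)"
      using pi_gt3 by (intro mult_right_mono) auto
    ultimately show ?thesis by linarith
  qed
  ultimately show ?thesis by blast
qed

end

lemma approximation_const_pos: "approximation_const > 0"
  using kernel_const_pos by (simp add: approximation_const_def add_pos_nonneg)

section \<open>Extension to the plane and choice of the mesh\<close>

lemma compact_support_uniformly_continuous:
  fixes f :: "complex \<Rightarrow> complex"
  assumes f: "continuous_on UNIV f" and supp: "\<And>z. L \<le> cmod z \<Longrightarrow> f z = 0" and e: "e > 0"
  obtains \<delta> where "\<delta> > 0" "\<And>x y. cmod (x - y) < \<delta> \<Longrightarrow> cmod (f x - f y) < e"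
proof -
  have "uniformly_continuous_on (cball 0 (L + 1)) f"
    using f by (intro compact_uniformly_continuous) (auto intro: continuous_on_subset)
  then obtain \<delta> where \<delta>: "\<delta> > 0"
      "\<And>x y. \<lbrakk>x \<in> cball 0 (L + 1); y \<in> cball 0 (L + 1); dist x y < \<delta>\<rbrakk> \<Longrightarrow> dist (f x) (f y) < e"
    using e unfolding uniformly_continuous_on_def by metis
  show ?thesis
  \<comment> \<open>Capping the distance at 1 ensures that if one point leaves the disc of radius
    \<open>L + 1\<close>, both have modulus at least \<open>L\<close>, where \<open>f\<close>
    vanishes.\<close>
  proof (rule that[of "min \<delta> 1"])
    fix x y assume xy: "cmod (x - y) < min \<delta> 1"
    show "cmod (f x - f y) < e"
    proof (cases "cmod x \<le> L + 1 \<and> cmod y \<le> L + 1")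
      case True
      then show ?thesis using \<delta>(2)[of x y] xy by (simp add: dist_norm)
    next
      case False
      then have "L \<le> cmod x \<and> L \<le> cmod y"
        using xy norm_triangle_ineq2[of x y] norm_triangle_ineq2[of y x] norm_minus_commute[of x y] by auto
      then show ?thesis using supp e by simp
    qed
  qed (use \<delta> in auto)
qed

lemma continuous_extension_compact_support:
  fixes f :: "complex \<Rightarrow> complex"
  assumes K: "compact K" "K \<subseteq> cball 0 B" "K \<noteq> {}" and f: "continuous_on K f"
  obtains g where "continuous_on UNIV g" "\<And>z. z \<in> K \<Longrightarrow> g z = f z" "\<And>z. B + 1 \<le> cmod z \<Longrightarrow> g z = 0"
proof -
  obtain h where h: "continuous_on UNIV h" "\<And>z. z \<in> K \<Longrightarrow> h z = f z"
    using Tietze_unbounded[OF f, of UNIV] K by (auto simp: compact_imp_closed)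
  \<comment> \<open>The Tietze extension is multiplied by a cutoff that is 1 on \<open>K\<close> and
    0 at distance at least 1 from \<open>K\<close>.\<close>
  define g where "g z = of_real (max 0 (1 - infdist z K)) * h z" for z
  show ?thesis
  proof (rule that[of g])
    show "continuous_on UNIV g" unfolding g_def
      by (intro continuous_intros h(1))
    show "g z = f z" if "z \<in> K" for z using that h by (simp add: g_def)
    show "g z = 0" if z: "B + 1 \<le> cmod z" for z
    proof -
      obtain w where w: "w \<in> K" "infdist z K = dist z w"
        using infdist_attains_inf[OF compact_imp_closed[OF K(1)] K(3)] by blast
      have "dist z w \<ge> 1"
        using w K(2) z norm_triangle_ineq2[of z w] by (force simp: dist_norm)
      then show ?thesis using w by (simp add: g_def)
    qed
  qed
qed

theorem Mergelyan:
  assumes K: "compact K" "connected (- K)" and f: "continuous_on K f" "f holomorphic_on interior K"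
  shows "poly_limit_on K f"
proof (cases "K = {}")
  case True
  then show ?thesis by (simp add: poly_limit_on_def)
next
  case False
  obtain B where "B > 0" "\<forall>z\<in>K. cmod z \<le> B"
    using compact_imp_bounded[OF K(1)] unfolding bounded_pos by blast
  then have B: "B > 0" "K \<subseteq> cball 0 B" by auto
  obtain g where g: "continuous_on UNIV g" "\<And>z. z \<in> K \<Longrightarrow> g z = f z" "\<And>z. B + 1 \<le> cmod z \<Longrightarrow> g z = 0"
    using continuous_extension_compact_support[OF K(1) B(2) False f(1)] by blast
  have gh: "g holomorphic_on interior K"
    using f(2) by (rule holomorphic_transform) (use g(2) interior_subset in force)
  show ?thesis
  proof (rule poly_limit_on_approx)
    fix e :: real assume e: "e > 0"
    define e' where "e' = e / (2 * approximation_const)"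
    have e': "e' > 0" using e approximation_const_pos by (simp add: e'_def)
    obtain \<delta> where \<delta>: "\<delta> > 0" "\<And>x y. cmod (x - y) < \<delta> \<Longrightarrow> cmod (g x - g y) < e'"
      using compact_support_uniformly_continuous[OF g(1,3) e'] by blast
    define L where "L = B + 1"
    \<comment> \<open>The square of side \<open>2 * L\<close> is cut into \<open>Suc n\<close>
      strips each way. The condition says \<open>d * (1 + 5 / \<delta>) < 1\<close>, which encodes
      both \<open>5 * d < \<delta>\<close> for the oscillation and \<open>d < 1\<close>, so that
      \<open>K\<close> avoids the outermost layer of cells.\<close>
    obtain n where n: "real (Suc n) > 2 * L * (1 + 5 / \<delta>)"
      using reals_Archimedean2 by (metis less_trans lessI of_nat_less_iff)
    define d where "d = 2 * L / real (Suc n)"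
    have dS: "d * real (Suc n) = 2 * L" by (simp add: d_def)
    have d: "d > 0" using B(1) by (simp add: d_def L_def)
    have "d * (1 + 5 / \<delta>) < 1"
      using n by (simp add: d_def divide_simps) 
    then have "d + 5 * d / \<delta> < 1" by (simp add: algebra_simps)
    moreover have "5 * d / \<delta> > 0" using d \<delta>(1) by simp
    ultimately have "d < 1" "5 * d / \<delta> < 1" using d by linarith+
    then have "5 * d < \<delta>" using \<delta>(1) by simp
    define a where "a = Complex (- L) (- L)"
    interpret square_grid a d by standard (rule d)
    have dn: "d * real n = 2 * L - d" using dS by (simp add: algebra_simps)
    have "\<exists>F. poly_limit_on K F \<and> (\<forall>z\<in>K. cmod (F z - g z) \<le> approximation_const * e')"
    proof (rule grid_approximation[OF K g(1) gh])
      show "cmod (g x - g y) \<le> e'" if "cmod (x - y) \<le> 5 * d" for x y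
        using \<delta>(2)[of x y] that \<open>5 * d < \<delta>\<close> by simp
      show "g \<zeta> = 0" if "\<zeta> \<notin> box (pt 0 0) (pt (Suc n) (Suc n))" for \<zeta>
      proof (rule g(3))
        have "L \<le> \<bar>Re \<zeta>\<bar> \<or> L \<le> \<bar>Im \<zeta>\<bar>"
          using that unfolding in_box_complex_iff Re_pt Im_pt dS by (auto simp: a_def)
        then show "B + 1 \<le> cmod \<zeta>"
          unfolding L_def using abs_Re_le_cmod[of \<zeta>] abs_Im_le_cmod[of \<zeta>] by linarith
      qed
      show "K \<subseteq> box (pt 1 1) (pt n n)"
      proof
        fix z assume "z \<in> K"
        then have "\<bar>Re z\<bar> \<le> B" "\<bar>Im z\<bar> \<le> B"
          using B(2) abs_Re_le_cmod[of z] abs_Im_le_cmod[of z] by auto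
        then show "z \<in> box (pt 1 1) (pt n n)"
          using \<open>d < 1\<close> unfolding in_box_complex_iff Re_pt Im_pt dn by (auto simp: a_def L_def)
      qed
    qed
    then obtain F where F: "poly_limit_on K F" "\<forall>z\<in>K. cmod (F z - g z) \<le> approximation_const * e'"
      by blast
    have "approximation_const * e' = e / 2" using approximation_const_pos by (simp add: e'_def)
    then have "\<forall>z\<in>K. cmod (f z - F z) < e"
      using F(2) e g(2) by (metis field_sum_of_halves less_add_same_cancel1 le_less_trans norm_minus_commute half_gt_zero)
    then show "\<exists>F. poly_limit_on K F \<and> (\<forall>z\<in>K. cmod (f z - F z) < e)" using F(1) by blast
  qed
qed

section \<open>Zero-free approximation\<close>

text \<open>Induction on the degree: split off one root in \<open>E\<close>, treat the cofactor
  first, then move the root to a nearby point off \<open>E\<close>. The order matters, since how far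
  the root may move depends on the bound \<open>C\<close> for the new cofactor. Roots of the
  cofactor are roots of \<open>P\<close>, so the hypothesis on roots persists.\<close>

lemma move_roots_off_set:
  fixes P :: "complex poly"
  assumes "compact E" "\<And>z. \<lbrakk>z \<in> E; poly P z = 0\<rbrakk> \<Longrightarrow> z \<in> closure (- E)" "e > 0"
  shows "\<exists>Q. (\<forall>z\<in>E. poly Q z \<noteq> 0) \<and> (\<forall>z\<in>E. cmod (poly P z - poly Q z) < e)"
  using assms(2,3)
proof (induction "degree P" arbitrary: P e rule: less_induct)
  case less
  consider "P = 0" | "\<forall>z\<in>E. poly P z \<noteq> 0" | z0 where "P \<noteq> 0" "z0 \<in> E" "poly P z0 = 0" by blast
  then show ?case
  proof cases
    case 1
    then show ?thesis using less.prems(2) by (intro exI[of _ "[:of_real (e / 2):]"]) (simp add: norm_divide)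
  next
    case 2
    then show ?thesis using less.prems(2) by (intro exI[of _ P]) auto
  next
    case (3 z0)
    then obtain P1 where P1: "P = [:- z0, 1:] * P1" by (metis dvdE poly_eq_0_iff_dvd)
    have "P1 \<noteq> 0" using 3 P1 by auto
    then have deg: "degree P1 < degree P" unfolding P1 by (subst degree_mult_eq) auto
    obtain M where M: "M > 0" "\<And>z. z \<in> E \<Longrightarrow> cmod (z - z0) \<le> M"
      using poly_limit_on_bounded[OF assms(1) poly_limit_on_poly[of E "[:- z0, 1:]"]] by auto
    have "\<exists>Q. (\<forall>z\<in>E. poly Q z \<noteq> 0) \<and> (\<forall>z\<in>E. cmod (poly P1 z - poly Q z) < e / (2 * M))"
      using less.prems M(1) by (intro less.hyps deg) (auto simp: P1)
    then obtain Q1 where Q1: "\<forall>z\<in>E. poly Q1 z \<noteq> 0" "\<forall>z\<in>E. cmod (poly P1 z - poly Q1 z) < e / (2 * M)"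
      by blast
    obtain C where C: "C > 0" "\<And>z. z \<in> E \<Longrightarrow> cmod (poly Q1 z) \<le> C"
      using poly_limit_on_bounded[OF assms(1) poly_limit_on_poly[of E Q1]] by blast
    have "z0 \<in> closure (- E)" using less.prems(1) 3 by blast
    then obtain w where w: "w \<notin> E" "dist w z0 < e / (2 * C)"
      using less.prems(2) C(1) unfolding closure_approachable by (metis ComplD divide_pos_pos mult_pos_pos zero_less_numeral)
    show ?thesis
    proof (intro exI[of _ "[:- w, 1:] * Q1"] conjI ballI)
      fix z assume z: "z \<in> E"
      show "poly ([:- w, 1:] * Q1) z \<noteq> 0" using z w(1) Q1(1) by auto
      have "poly P z - poly ([:- w, 1:] * Q1) z = (z - z0) * (poly P1 z - poly Q1 z) + (w - z0) * poly Q1 z"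
        unfolding P1 by (simp add: algebra_simps)
      then have "cmod (poly P z - poly ([:- w, 1:] * Q1) z) \<le>
          cmod (z - z0) * cmod (poly P1 z - poly Q1 z) + cmod (w - z0) * cmod (poly Q1 z)"
        by (metis norm_triangle_ineq norm_mult)
      also have "\<dots> \<le> M * cmod (poly P1 z - poly Q1 z) + cmod (w - z0) * C"
        using M C z by (intro add_mono mult_right_mono mult_left_mono) auto
      also have "\<dots> < M * (e / (2 * M)) + e / (2 * C) * C"
        using M(1) C(1) Q1(2) z w(2)
        by (intro add_strict_mono mult_strict_left_mono mult_strict_right_mono) (auto simp: dist_norm)
      also have "\<dots> = e" using M(1) C(1) by simp
      finally show "cmod (poly P z - poly ([:- w, 1:] * Q1) z) < e" .
    qed
  qed
qed

theorem theorem2: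
  fixes E :: "complex set" and f :: "complex \<Rightarrow> complex" and \<epsilon> :: real
  assumes "compact E"
    and "connected (- E)"
    and "f \<in> space_A E"
    and "\<And>z. z \<in> interior E \<Longrightarrow> f z \<noteq> 0"
    and "(\<forall>z\<in>interior E. Re (f z) \<ge> 0) \<or> (\<forall>z\<in>interior E. Re (f z) \<le> 0) \<or>
         (\<forall>z\<in>interior E. Im (f z) \<ge> 0) \<or> (\<forall>z\<in>interior E. Im (f z) \<le> 0)"
    and "\<epsilon> > 0"
  shows "\<exists>P :: complex poly. (\<forall>z\<in>E. poly P z \<noteq> 0) \<and> (\<forall>z\<in>E. cmod (f z - poly P z) < \<epsilon>)"
proof -
  \<comment> \<open>A unit factor rotates each of the four cases into the closed right half
    plane.\<close>
  have "\<exists>u. cmod u = 1 \<and> (\<forall>z\<in>interior E. Re (u * f z) \<ge> 0)"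
    using assms(5)
  proof (elim disjE)
    assume "\<forall>z\<in>interior E. Re (f z) \<ge> 0"
    then show ?thesis by (intro exI[of _ 1]) auto
  next
    assume "\<forall>z\<in>interior E. Re (f z) \<le> 0"
    then show ?thesis by (intro exI[of _ "-1"]) auto
  next
    assume "\<forall>z\<in>interior E. Im (f z) \<ge> 0"
    then show ?thesis by (intro exI[of _ "- \<i>"]) auto
  next
    assume "\<forall>z\<in>interior E. Im (f z) \<le> 0"
    then show ?thesis by (intro exI[of _ "\<i>"]) auto
  qed
  then obtain u where u: "cmod u = 1" "\<And>z. z \<in> interior E \<Longrightarrow> Re (u * f z) \<ge> 0" by blast
  then have u0: "u \<noteq> 0" by auto
  \<comment> \<open>One \<open>\<eta>\<close> goes to the Mergelyan approximation, one to the shift,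
    and the remaining \<open>\<epsilon> / 2\<close> to moving the roots.\<close>
  define \<eta> where "\<eta> = \<epsilon> / 4"
  have \<eta>: "\<eta> > 0" using assms(6) by (simp add: \<eta>_def)
  have "poly_limit_on E f"
    using assms(3) by (intro Mergelyan assms(1,2)) (auto simp: space_A_def analytic_imp_holomorphic)
  then obtain P0 where P0: "\<forall>z\<in>E. cmod (f z - poly P0 z) < \<eta>"
    using \<eta> unfolding poly_limit_on_def by blast
  \<comment> \<open>After multiplication by \<open>u\<close> the added constant becomes
    \<open>\<eta>\<close>, which strictly exceeds the approximation error. So
    \<open>u * poly P z\<close> has positive real part on the interior, and every root of
    \<open>P\<close> in \<open>E\<close> is a limit of points of the complement.\<close>
  define P where "P = P0 + [:of_real \<eta> / u:]"
  have "z \<in> closure (- E)" if z: "z \<in> E" "poly P z = 0" for z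
  proof (rule ccontr)
    assume "z \<notin> closure (- E)"
    then have zi: "z \<in> interior E" by (simp add: closure_complement)
    have "u * poly P z = u * f z - u * (f z - poly P0 z) + of_real \<eta>"
      using u0 by (simp add: P_def algebra_simps)
    then have "Re (u * poly P z) = Re (u * f z) - Re (u * (f z - poly P0 z)) + \<eta>"
      by (simp only: plus_complex.sel minus_complex.sel Re_complex_of_real)
    moreover have "Re (u * (f z - poly P0 z)) < \<eta>"
      using complex_Re_le_cmod[of "u * (f z - poly P0 z)"] P0 z(1) u(1) by (force simp: norm_mult)
    ultimately have "Re (u * poly P z) > 0" using u(2)[OF zi] by linarith
    then show False using z(2) by simp
  qed
  then obtain Q where Q: "\<forall>z\<in>E. poly Q z \<noteq> 0" "\<forall>z\<in>E. cmod (poly P z - poly Q z) < \<epsilon> / 2"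
    using move_roots_off_set[OF assms(1), of P "\<epsilon> / 2"] assms(6) by auto
  have "cmod (f z - poly Q z) < \<epsilon>" if z: "z \<in> E" for z
  proof -
    have "f z - poly Q z = (f z - poly P0 z) + (poly P z - poly Q z) - of_real \<eta> / u"
      by (simp add: P_def)
    then have "cmod (f z - poly Q z) \<le> cmod (f z - poly P0 z) + cmod (poly P z - poly Q z) + cmod (of_real \<eta> / u)"
      by (metis norm_triangle_ineq norm_triangle_ineq4 add_right_mono order_trans)
    moreover have "cmod (of_real \<eta> / u) = \<eta>" using u(1) \<eta> by (simp add: norm_divide)
    moreover have "cmod (f z - poly P0 z) < \<eta>" "cmod (poly P z - poly Q z) < \<epsilon> / 2"
      using P0 Q(2) z by auto
    ultimately show ?thesis by (simp add: \<eta>_def)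
  qed
  with Q(1) show ?thesis by blast
qed

end
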